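(* Let $p\in(0,1]$, $\alpha=1-p$, and $\tau=\frac{\sqrt{1-\alpha}}{L}\gamma$ for $\gamma\in(0,1)$. Then the average total complexity of extragradient with variance reduction (described in the context) to reach $\varepsilon$-accuracy, with output $\mathbf z^K=\frac1K\sum_{k=0}^{K-1}\mathbf z_{k+1/2}$, is $$\mathcal O\left(N+(pN+2)\left(1+\frac{L}{\sqrt p\,\varepsilon}\right)\right).$$ In particular, for $p=\frac2N$ it is $\mathcal O\left(N+\frac{\sqrt N L}{\varepsilon}\right)$.
   Context: Let $\mathcal Z$ be a finite-dimensional vector space with Euclidean inner product $\langle\cdot,\cdot\rangle$ and norm $\|\cdot\|$. Let $g:\mathcal Z\to\mathbb R\cup\{+\infty\}$ be proper convex lower semicontinuous, with $\operatorname{dom} g=\{\mathbf z: g(\mathbf z)<+\infty\}$ and $\operatorname{prox}_g(\mathbf x)=\operatorname{argmin}_{\mathbf y}\{g(\mathbf y)+\frac12\|\mathbf y-\mathbf x\|^2\}$. Problem: find $\mathbf z_*\in\mathcal Z$ such that $\langle F(\mathbf z_* ),\mathbf z-\mathbf z_*\rangle+g(\mathbf z)-g(\mathbf z_* )\ge 0$ for all $\mathbf z\in\mathcal Z$. The set of solutions of this problem is assumed nonempty. The operator $F:\operatorname{dom} g\to\mathcal Z$ is monotone: $\langle F(\mathbf x)-F(\mathbf y),\mathbf x-\mathbf y\rangle\ge 0$ for all $\mathbf x,\mathbf y$. It has a stochastic oracle $F_\xi$, with $\xi$ distributed according to $Q$, that is unbiased, $F(\mathbf z)=\mathbb E[F_\xi(\mathbf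 z)]$, and $L$-Lipschitz in mean: $\mathbb E\left[\|F_\xi(\mathbf u)-F_\xi(\mathbf v)\|^2\right]\le L^2\|\mathbf u-\mathbf v\|^2$ for all $\mathbf u,\mathbf v\in\mathcal Z$. Extragradient with variance reduction: given a probability $p$, a probability distribution $Q$, a step size $\tau$, a parameter $\alpha$ and $\mathbf z_0=\mathbf w_0$, for $k=0,1,\dots$: set $\bar{\mathbf z}_k=\alpha\mathbf z_k+(1-\alpha)\mathbf w_k$; $\mathbf z_{k+1/2}=\operatorname{prox}_{\tau g}(\bar{\mathbf z}_k-\tau F(\mathbf w_k))$; draw an index $\xi_k$ according to $Q$; $\mathbf z_{k+1}=\operatorname{prox}_{\tau g}(\bar{\mathbf z}_k-\tau[F(\mathbf w_k)+F_{\xi_k}(\mathbf z_{k+1/2})-F_{\xi_k}(\mathbf w_k)])$; $\mathbf w_{k+1}=\mathbf z_{k+1}$ with probability $p$ and $\mathbf w_{k+1}=\mathbf w_k$ with probability $1-p$. Gap function: $\mathrm{Gap}(\mathbf w)=\max_{\mathbf z\in\mathcal C}\{\langle F(\mathbf z),\mathbf w-\mathbf z\rangle+g(\mathbf w)-g(\mathbf z)\}$, where $\mathcal C$ is a compact subset of $\mathcal Z$ (used to handle the possibility that $\operatorname{dom} g$ is unbounded). A point $\bar{\mathbf z}$ is $\varepsilon$-accurate if $\mathbb E[\mathrm{Gap}(\bar{\mathbf z})]\le\varepsilon$. Complexity is measured in calls to the stochastic oracle $F_\xi$, where the cost of computing $F$ is assumed to be $N$ times that of $F_\xi$. The per-iteration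 cost of the algorithm is $pN+2$ calls to $F_\xi$ in expectation. "Average total complexity" means the expected number of calls to $F_\xi$ to get expected gap at most $\varepsilon$. *)

theory Defs
  imports "HOL-Probability.Probability"
begin

section \<open>Extended-valued convex functions and the proximal operator\<close>

definition eff_dom :: "('a \<Rightarrow> ereal) \<Rightarrow> 'a set" where
  "eff_dom g = {z. g z < \<infinity>}"

text \<open>
  The value minus infinity is excluded, so the sum on the right-hand side of \<open>convex_ext\<close>
  is never of the form infinity minus infinity; moreover \<open>0 * \<infinity> = 0\<close> in \<^typ>\<open>ereal\<close>.
\<close>

definition proper_ext :: "('a \<Rightarrow> ereal) \<Rightarrow> bool" where
  "proper_ext g \<longleftrightarrow> (\<forall>z. g z \<noteq> -\<infinity>) \<and> eff_dom g \<noteq> {}"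

definition convex_ext :: "('a::real_vector \<Rightarrow> ereal) \<Rightarrow> bool" where
  "convex_ext g \<longleftrightarrow>
     (\<forall>x y. \<forall>t\<in>{0..1}.
        g ((1 - t) *\<^sub>R x + t *\<^sub>R y) \<le> ereal (1 - t) * g x + ereal t * g y)"

definition lsc_ext :: "('a::topological_space \<Rightarrow> ereal) \<Rightarrow> bool" where
  "lsc_ext g \<longleftrightarrow> (\<forall>x. g x \<le> Liminf (at x) g)"

definition prox :: "('a::euclidean_space \<Rightarrow> ereal) \<Rightarrow> 'a \<Rightarrow> 'a" where
  "prox h x = (ARG_MIN (\<lambda>y. h y + ereal (1/2 * (norm (y - x))\<^sup>2)) y. True)"


section \<open>Monotone variational inequality with a stochastic oracle\<close>

text \<open>
  The operator \<open>F\<close> lives on \<open>eff_dom g\<close>; it is a total function here, but nothing is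
  assumed about its values elsewhere. Joint measurability of the oracle makes the composition
  \<open>F\<^sub>\<xi> i z\<close> with random \<open>i\<close> and \<open>z\<close> a random variable; it is automatic
  when \<open>Q\<close> gives positive probability to each of finitely many indices. The second moment in \<open>lipschitz_in_mean\<close> is
  a Lebesgue integral of a nonnegative function, so that its finiteness is part of the bound.
\<close>

locale stochastic_vi =
  fixes g :: "'a::euclidean_space \<Rightarrow> ereal"
    and F :: "'a \<Rightarrow> 'a"
    and Q :: "'i measure"
    and F\<^sub>\<xi> :: "'i \<Rightarrow> 'a \<Rightarrow> 'a"
    and L :: real
  assumes proper: "proper_ext g"
    and convex: "convex_ext g"
    and lsc: "lsc_ext g"
    and monotone: "\<And>x y. x \<in> eff_dom g \<Longrightarrow> y \<in> eff_dom g \<Longrightarrow> (F x - F y) \<bullet> (x - y) \<ge> 0"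
    and prob_Q: "prob_space Q"
    and oracle_measurable: "(\<lambda>(i, z). F\<^sub>\<xi> i z) \<in> borel_measurable (Q \<Otimes>\<^sub>M borel)"
    and oracle_integrable: "\<And>z. z \<in> eff_dom g \<Longrightarrow> integrable Q (\<lambda>i. F\<^sub>\<xi> i z)"
    and unbiased: "\<And>z. z \<in> eff_dom g \<Longrightarrow> F z = (\<integral>i. F\<^sub>\<xi> i z \<partial>Q)"
    and L_pos: "L > 0"
    and lipschitz_in_mean:
      "\<And>u v. (\<integral>\<^sup>+i. ennreal ((norm (F\<^sub>\<xi> i u - F\<^sub>\<xi> i v))\<^sup>2) \<partial>Q) \<le> ennreal (L\<^sup>2 * (norm (u - v))\<^sup>2)"

text \<open>
  Membership in \<open>eff_dom g\<close> is implied by the inequality for proper \<open>g\<close>; it is stated because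
  \<open>F\<close> is only meaningful there and \<open>\<infinity> - \<infinity> = \<infinity>\<close> in \<^typ>\<open>ereal\<close>.
\<close>

definition vi_solutions :: "('a::euclidean_space \<Rightarrow> ereal) \<Rightarrow> ('a \<Rightarrow> 'a) \<Rightarrow> 'a set" where
  "vi_solutions g F =
     {zs \<in> eff_dom g. \<forall>z. ereal (F zs \<bullet> (z - zs)) + g z - g zs \<ge> 0}"

text \<open>
  Points \<open>z\<close> outside \<open>eff_dom g\<close> contribute \<open>-\<infinity>\<close> to the maximum (and \<open>F\<close> is not defined
  there), so the maximum ranges over \<open>C \<inter> eff_dom g\<close>.
\<close>

definition Gap :: "('a::euclidean_space \<Rightarrow> ereal) \<Rightarrow> ('a \<Rightarrow> 'a) \<Rightarrow> 'a set \<Rightarrow> 'a \<Rightarrow> ereal" where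
  "Gap g F C w = (SUP z\<in>C \<inter> eff_dom g. ereal (F z \<bullet> (w - z)) + g w - g z)"


section \<open>Extragradient with variance reduction\<close>

definition half_step ::
  "('a::euclidean_space \<Rightarrow> ereal) \<Rightarrow> ('a \<Rightarrow> 'a) \<Rightarrow> real \<Rightarrow> real \<Rightarrow> 'a \<Rightarrow> 'a \<Rightarrow> 'a" where
  "half_step g F \<alpha> \<tau> z w =
     prox (\<lambda>y. ereal \<tau> * g y) (\<alpha> *\<^sub>R z + (1 - \<alpha>) *\<^sub>R w - \<tau> *\<^sub>R F w)"

definition full_step ::
  "('a::euclidean_space \<Rightarrow> ereal) \<Rightarrow> ('a \<Rightarrow> 'a) \<Rightarrow> ('i \<Rightarrow> 'a \<Rightarrow> 'a) \<Rightarrow> real \<Rightarrow> real \<Rightarrow>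
   'i \<Rightarrow> 'a \<Rightarrow> 'a \<Rightarrow> 'a" where
  "full_step g F F\<^sub>\<xi> \<alpha> \<tau> i z w =
     prox (\<lambda>y. ereal \<tau> * g y)
       (\<alpha> *\<^sub>R z + (1 - \<alpha>) *\<^sub>R w
        - \<tau> *\<^sub>R (F w + F\<^sub>\<xi> i (half_step g F \<alpha> \<tau> z w) - F\<^sub>\<xi> i w))"

text \<open>
  An outcome \<open>\<omega>\<close> of the randomness of a run assigns to each iteration \<open>k\<close> the index
  \<open>\<xi>\<^sub>k = fst (\<omega> k)\<close> and the coin \<open>snd (\<omega> k)\<close> that decides whether the snapshot is
  updated. All draws are independent.
\<close>

definition draws :: "'i measure \<Rightarrow> real \<Rightarrow> (nat \<Rightarrow> 'i \<times> bool) measure" where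
  "draws Q p = Pi\<^sub>M UNIV (\<lambda>_. Q \<Otimes>\<^sub>M measure_pmf (bernoulli_pmf p))"

text \<open>The pair of iterates \<open>(z\<^sub>k, w\<^sub>k)\<close>.\<close>

primrec iterates ::
  "('a::euclidean_space \<Rightarrow> ereal) \<Rightarrow> ('a \<Rightarrow> 'a) \<Rightarrow> ('i \<Rightarrow> 'a \<Rightarrow> 'a) \<Rightarrow> real \<Rightarrow> real \<Rightarrow> 'a \<Rightarrow>
   (nat \<Rightarrow> 'i \<times> bool) \<Rightarrow> nat \<Rightarrow> 'a \<times> 'a" where
  "iterates g F F\<^sub>\<xi> \<alpha> \<tau> z0 \<omega> 0 = (z0, z0)"
| "iterates g F F\<^sub>\<xi> \<alpha> \<tau> z0 \<omega> (Suc k) =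
     (let (z, w) = iterates g F F\<^sub>\<xi> \<alpha> \<tau> z0 \<omega> k;
          z' = full_step g F F\<^sub>\<xi> \<alpha> \<tau> (fst (\<omega> k)) z w
      in (z', if snd (\<omega> k) then z' else w))"

definition half_iterate ::
  "('a::euclidean_space \<Rightarrow> ereal) \<Rightarrow> ('a \<Rightarrow> 'a) \<Rightarrow> ('i \<Rightarrow> 'a \<Rightarrow> 'a) \<Rightarrow> real \<Rightarrow> real \<Rightarrow> 'a \<Rightarrow>
   (nat \<Rightarrow> 'i \<times> bool) \<Rightarrow> nat \<Rightarrow> 'a" where
  "half_iterate g F F\<^sub>\<xi> \<alpha> \<tau> z0 \<omega> k =
     (let (z, w) = iterates g F F\<^sub>\<xi> \<alpha> \<tau> z0 \<omega> k in half_step g F \<alpha> \<tau> z w)"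

definition avg_output ::
  "('a::euclidean_space \<Rightarrow> ereal) \<Rightarrow> ('a \<Rightarrow> 'a) \<Rightarrow> ('i \<Rightarrow> 'a \<Rightarrow> 'a) \<Rightarrow> real \<Rightarrow> real \<Rightarrow> 'a \<Rightarrow>
   nat \<Rightarrow> (nat \<Rightarrow> 'i \<times> bool) \<Rightarrow> 'a" where
  "avg_output g F F\<^sub>\<xi> \<alpha> \<tau> z0 K \<omega> =
     (1 / real K) *\<^sub>R (\<Sum>k<K. half_iterate g F F\<^sub>\<xi> \<alpha> \<tau> z0 \<omega> k)"


section \<open>Accuracy and complexity\<close>

text \<open>
  Expectation of an extended-real random variable: the integral of the positive part minus the
  integral of the negative part. If both are infinite, the value is \<open>\<infinity>\<close> and the variable is
  not accurate in the sense below.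
\<close>

definition ext_expectation :: "'w measure \<Rightarrow> ('w \<Rightarrow> ereal) \<Rightarrow> ereal" where
  "ext_expectation M X =
     enn2ereal (\<integral>\<^sup>+\<omega>. e2ennreal (X \<omega>) \<partial>M) - enn2ereal (\<integral>\<^sup>+\<omega>. e2ennreal (- X \<omega>) \<partial>M)"

definition accurate ::
  "('a::euclidean_space \<Rightarrow> ereal) \<Rightarrow> ('a \<Rightarrow> 'a) \<Rightarrow> 'a set \<Rightarrow> 'w measure \<Rightarrow> ('w \<Rightarrow> 'a) \<Rightarrow> real \<Rightarrow> bool" where
  "accurate g F C M zbar \<epsilon> \<longleftrightarrow>
     (\<lambda>\<omega>. Gap g F C (zbar \<omega>)) \<in> borel_measurable M \<and>
     ext_expectation M (\<lambda>\<omega>. Gap g F C (zbar \<omega>)) \<le> ereal \<epsilon>"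

text \<open>
  Calls to the stochastic oracle in the first \<open>K\<close> iterations, one evaluation of \<open>F\<close> costing \<open>N\<close>
  calls: \<open>F w\<^sub>0\<close> is computed at the start; each iteration makes two calls, and computes \<open>F\<close> at
  the new snapshot when the snapshot changes. The expected cost of one iteration is \<open>p * N + 2\<close>.
\<close>

definition oracle_calls :: "nat \<Rightarrow> nat \<Rightarrow> (nat \<Rightarrow> 'i \<times> bool) \<Rightarrow> nat" where
  "oracle_calls N K \<omega> = N + (\<Sum>k<K. 2 + (if snd (\<omega> k) then N else 0))"

text \<open>
  Since the expected number of calls increases with \<open>K\<close>, the infimum is attained at the first
  iteration count whose output is \<open>\<epsilon>\<close>-accurate; it is \<open>\<infinity>\<close> if the accuracy is never reached.
\<close>

definition avg_total_complexity ::
  "('a::euclidean_space \<Rightarrow> ereal) \<Rightarrow> ('a \<Rightarrow> 'a) \<Rightarrow> 'i measure \<Rightarrow> ('i \<Rightarrow> 'a \<Rightarrow> 'a) \<Rightarrow> 'a set \<Rightarrow> nat \<Rightarrow>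
   real \<Rightarrow> real \<Rightarrow> real \<Rightarrow> 'a \<Rightarrow> real \<Rightarrow> ereal" where
  "avg_total_complexity g F Q F\<^sub>\<xi> C N p \<alpha> \<tau> z0 \<epsilon> =
     (INF K \<in> {K. K \<ge> 1 \<and> accurate g F C (draws Q p) (avg_output g F F\<^sub>\<xi> \<alpha> \<tau> z0 K) \<epsilon>}.
        ereal (\<integral>\<omega>. real (oracle_calls N K \<omega>) \<partial>draws Q p))"

end

theory Submission
  imports Defs
begin

text \<open>
  Write \<open>z, w\<close> for the current iterate and snapshot, \<open>h\<close> for the half step, \<open>n\<close> for the next
  iterate, \<open>zs\<close> for a solution, and \<open>\<Phi> v z w = (1 - p) |z - v|\<^sup>2 + |w - v|\<^sup>2\<close>. The proof splits the
  oracle error of an iteration into a part that does not depend on the comparison point of the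
  gap and a part that is linear in it.

  The optimality conditions of the two proximal steps give, for each point \<open>v\<close> of the domain,
  a bound on \<open>2 \<tau> (F v \<bullet> (h - v) + g h - g v) + \<Phi> v n w'\<close> (\<open>w'\<close> the next snapshot) by
  \<open>\<Phi> v z w + incr - drift \<bullet> (v - zs)\<close>, where neither \<open>incr\<close> nor \<open>drift\<close> mentions \<open>v\<close>
  (\<open>telescoping_step\<close>). Summed over the run, the supremum over the \<open>v\<close> at
  distance at most \<open>R\<close> from the start costs, besides a multiple of \<open>R\<^sup>2\<close>, only half the squared norm
  of the accumulated drift (\<open>gap_at_average_le\<close>). The accumulated drift is a martingale, so this
  square has a mean controlled by the one-step variances, and these are at most
  a multiple of the mean of \<open>|n - h|\<^sup>2 + p |h - w|\<^sup>2\<close>, a quantity that \<open>\<Phi> zs\<close> loses in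
  expectation during one step, up to the factor \<open>1 - \<gamma>\<close>.

  All of this is packed into a single nonnegative supermartingale: the accumulated
  \<open>incr\<close> (started at the initial \<open>\<Phi> zs\<close>), plus half the squared norm of the accumulated drift,
  plus a multiple of \<open>\<Phi> zs\<close> (\<open>potential_next_mean\<close>, \<open>run_potential_mean\<close>). The accumulated
  \<open>incr\<close> is signed a priori, but \<open>telescoping_step\<close> with \<open>v = zs\<close> shows that it dominates
  \<open>\<Phi> zs\<close> on every path (\<open>majorant_dominates\<close>). Hence every global expectation is
  an integral of a nonnegative function, and no integrability along the run has to be tracked.
  The resulting bound on the expected gap after \<open>K\<close> steps is a constant times \<open>R\<^sup>2 / (\<tau> K)\<close>, from
  which the iteration count and the expected number of oracle calls follow.
\<close>

section \<open>Lower semicontinuous convex functions and their proximal map\<close>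

text \<open>
  A real continuous perturbation of the level is allowed because \<open>g y + q y \<le> t\<close> with continuous
  real \<open>q\<close> is \<open>g y \<le> t - q y\<close>; this replaces a calculus of sums of lower semicontinuous functions.
\<close>

lemma closed_sublevel_of_lsc:
  fixes g :: "'a::topological_space \<Rightarrow> ereal" and f :: "'a \<Rightarrow> real"
  assumes "lsc_ext g" and "continuous_on UNIV f"
  shows "closed {y. g y \<le> ereal (f y)}"
proof -
  have "eventually (\<lambda>y. ereal (f y) < g y) (nhds x)" if fx: "ereal (f x) < g x" for x
  proof -
    obtain r where r: "ereal (f x) < ereal r" "ereal r < g x"
      using ereal_dense2[OF fx] by auto
    have "ereal r < Liminf (at x) g"
      using r assms(1) unfolding lsc_ext_def by (meson less_le_trans)
    then have "eventually (\<lambda>y. ereal r < g y) (at x)"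
      by (rule less_LiminfD)
    moreover have "(f \<longlongrightarrow> f x) (at x)"
      using assms(2) continuous_on_def by blast
    then have "eventually (\<lambda>y. f y < r) (at x)"
      using r(1) by (intro order_tendstoD(2)) auto
    ultimately have "eventually (\<lambda>y. ereal (f y) < g y) (at x)"
      by eventually_elim (auto intro: less_trans[of "ereal _" "ereal r"])
    with fx show ?thesis
      by (simp add: eventually_nhds_conv_at)
  qed
  then have "open {y. ereal (f y) < g y}"
    by (subst open_subopen) (force simp: eventually_nhds)
  moreover have "{y. g y \<le> ereal (f y)} = - {y. ereal (f y) < g y}"
    by auto
  ultimately show ?thesis
    by (simp add: closed_Compl)
qed

text \<open>
  The nonempty sublevel sets below level \<open>\<phi> y0\<close> are compact and totally ordered by inclusion, hence
  have a common point.
\<close>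

lemma attains_min_of_closed_sublevels:
  fixes \<phi> :: "'a::heine_borel \<Rightarrow> ereal"
  assumes closed: "\<And>t. closed {y. \<phi> y \<le> ereal t}"
    and bdd: "bounded {y. \<phi> y \<le> \<phi> y0}"
    and fin: "\<phi> y0 \<noteq> \<infinity>" and no_minf: "\<And>y. \<phi> y \<noteq> -\<infinity>"
  shows "\<exists>m. \<forall>y. \<phi> m \<le> \<phi> y"
proof -
  let ?S = "{y. \<phi> y \<le> \<phi> y0}"
  have cl: "closed {x. \<phi> x \<le> \<phi> y}" if "y \<in> ?S" for y
  proof -
    have "\<phi> y \<noteq> \<infinity>" using that fin by auto
    then obtain t where "\<phi> y = ereal t" using no_minf by (cases "\<phi> y") auto
    then show ?thesis using closed[of t] by simp
  qed
  have "?S \<inter> (\<Inter>y\<in>?S. {x. \<phi> x \<le> \<phi> y}) \<noteq> {}"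
  proof (rule compact_imp_fip_image)
    show "compact ?S" using bdd cl[of y0] by (simp add: compact_eq_bounded_closed)
    show "closed {x. \<phi> x \<le> \<phi> y}" if "y \<in> ?S" for y using cl[OF that] .
    fix I assume I: "finite I" "I \<subseteq> ?S"
    have "Min (\<phi> ` insert y0 I) \<in> \<phi> ` insert y0 I" using I by (intro Min_in) auto
    then obtain x where x: "\<phi> x = Min (\<phi> ` insert y0 I)" by force
    have "\<phi> x \<le> \<phi> y" if "y \<in> insert y0 I" for y
      unfolding x using I that by (intro Min_le) auto
    then show "?S \<inter> (\<Inter>y\<in>I. {x. \<phi> x \<le> \<phi> y}) \<noteq> {}" by auto
  qed
  then obtain m where "\<phi> m \<le> \<phi> y0" "\<And>y. \<phi> y \<le> \<phi> y0 \<Longrightarrow> \<phi> m \<le> \<phi> y" by auto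
  then have "\<phi> m \<le> \<phi> y" for y by (meson linear order_trans)
  then show ?thesis by blast
qed

text \<open>
  The affine minorant makes the objective of the proximal step coercive. Every proper convex lower
  semicontinuous function has one; for the variational inequality a solution provides it at once.
\<close>

locale minorized_convex =
  fixes g :: "'a::euclidean_space \<Rightarrow> ereal" and \<tau> :: real
  assumes g_proper: "proper_ext g" and g_convex: "convex_ext g" and g_lsc: "lsc_ext g"
    and minorant: "\<exists>a b. \<forall>y. ereal (a + b \<bullet> y) \<le> g y"
    and \<tau>_pos: "\<tau> > 0"
begin

definition G :: "'a \<Rightarrow> real" where
  "G z = real_of_ereal (g z)"

lemma g_eq_G: "z \<in> eff_dom g \<Longrightarrow> g z = ereal (G z)"
  using g_proper unfolding proper_ext_def eff_dom_def G_def by (cases "g z") auto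

lemma g_outside: "z \<notin> eff_dom g \<Longrightarrow> g z = \<infinity>"
  unfolding eff_dom_def by auto

lemma in_dom_iff: "z \<in> eff_dom g \<longleftrightarrow> g z \<noteq> \<infinity>"
  unfolding eff_dom_def by auto

lemma convex_comb_in_dom:
  assumes "x \<in> eff_dom g" "y \<in> eff_dom g" "0 \<le> t" "t \<le> 1"
  shows "(1 - t) *\<^sub>R x + t *\<^sub>R y \<in> eff_dom g"
    and "G ((1 - t) *\<^sub>R x + t *\<^sub>R y) \<le> (1 - t) * G x + t * G y"
proof -
  let ?c = "(1 - t) *\<^sub>R x + t *\<^sub>R y"
  have le: "g ?c \<le> ereal ((1 - t) * G x + t * G y)"
  proof -
    have "g ?c \<le> ereal (1 - t) * g x + ereal t * g y"
      using g_convex assms(3,4) unfolding convex_ext_def by simp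
    then show ?thesis by (simp add: g_eq_G assms)
  qed
  then show "?c \<in> eff_dom g"
    unfolding in_dom_iff by auto
  with le show "G ?c \<le> (1 - t) * G x + t * G y"
    by (simp add: g_eq_G)
qed

lemma convex_dom: "convex (eff_dom g)"
  unfolding convex_alt using convex_comb_in_dom(1) by blast

lemma convex_on_G: "convex_on (eff_dom g) G"
proof (rule convex_onI)
  show "convex (eff_dom g)" by (rule convex_dom)
qed (use convex_comb_in_dom(2) in auto)

lemma prox_minimizes:
  fixes x y :: 'a
  defines "P \<equiv> prox (\<lambda>y. ereal \<tau> * g y) x"
  shows "ereal \<tau> * g P + ereal (1/2 * (norm (P - x))\<^sup>2) \<le> ereal \<tau> * g y + ereal (1/2 * (norm (y - x))\<^sup>2)"
proof -
  define \<phi> where "\<phi> = (\<lambda>y. ereal \<tau> * g y + ereal (1/2 * (norm (y - x))\<^sup>2))"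
  obtain a b where ab: "\<And>y. ereal (a + b \<bullet> y) \<le> g y" using minorant by blast
  obtain y0 where y0: "y0 \<in> eff_dom g" using g_proper unfolding proper_ext_def by auto
  have dom: "\<phi> z = ereal (\<tau> * G z + 1/2 * (norm (z - x))\<^sup>2)" if "z \<in> eff_dom g" for z
    using g_eq_G[OF that] by (simp add: \<phi>_def)
  have out: "\<phi> z = \<infinity>" if "z \<notin> eff_dom g" for z
    using g_outside[OF that] \<tau>_pos by (simp add: \<phi>_def)
  have "\<exists>m. \<forall>y. \<phi> m \<le> \<phi> y"
  proof (rule attains_min_of_closed_sublevels)
    fix t :: real
    have "\<phi> z \<le> ereal t \<longleftrightarrow> g z \<le> ereal ((t - 1/2 * (norm (z - x))\<^sup>2) / \<tau>)" for z
      using \<tau>_pos by (cases "z \<in> eff_dom g") (auto simp: dom out g_eq_G g_outside field_simps)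
    then have "{y. \<phi> y \<le> ereal t} = {y. g y \<le> ereal ((t - 1/2 * (norm (y - x))\<^sup>2) / \<tau>)}"
      by auto
    moreover have "closed \<dots>"
      by (intro closed_sublevel_of_lsc g_lsc continuous_intros) (use \<tau>_pos in auto)
    ultimately show "closed {y. \<phi> y \<le> ereal t}" by simp
  next
    \<comment> \<open>Below level \<open>t\<close> the minorant forces \<open>n\<^sup>2 / 2 \<le> A + B n\<close> for \<open>n = norm (z - x)\<close>, which bounds \<open>n\<close>.\<close>
    define t where "t = \<tau> * G y0 + 1/2 * (norm (y0 - x))\<^sup>2"
    define A where "A = \<bar>t - \<tau> * (a + b \<bullet> x)\<bar>"
    define B where "B = \<tau> * norm b"
    have nn: "0 \<le> A" "0 \<le> B" unfolding A_def B_def using \<tau>_pos by auto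
    have "norm (z - x) \<le> 2 * (A + B + 1)" if "\<phi> z \<le> \<phi> y0" for z
    proof -
      have z: "z \<in> eff_dom g" using that out dom[OF y0] by (cases "z \<in> eff_dom g") auto
      have "\<tau> * (a + b \<bullet> z) \<le> \<tau> * G z"
        using ab[of z] g_eq_G[OF z] \<tau>_pos by simp
      moreover have "\<tau> * G z + 1/2 * (norm (z - x))\<^sup>2 \<le> t"
        using that by (simp add: dom z y0 t_def)
      moreover have "\<tau> * (a + b \<bullet> z) = \<tau> * (a + b \<bullet> x) + \<tau> * (b \<bullet> (z - x))"
        by (simp add: algebra_simps inner_diff_right)
      moreover have "\<tau> * (- (b \<bullet> (z - x))) \<le> \<tau> * (norm b * norm (z - x))"
        using \<tau>_pos Cauchy_Schwarz_ineq2[of b "z - x"] by (intro mult_left_mono) auto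
      ultimately have "1/2 * (norm (z - x))\<^sup>2 \<le> A + B * norm (z - x)"
        using abs_ge_self[of "t - \<tau> * (a + b \<bullet> x)"] unfolding A_def[symmetric] B_def
        by (simp add: algebra_simps)
      moreover have "A + B * n < 1/2 * n\<^sup>2" if "n > 2 * (A + B + 1)" for n
      proof -
        have "(A + B) * n \<le> 1/2 * n * n"
          using that nn by (intro mult_right_mono) auto
        moreover have "A * 1 \<le> A * n" using that nn by (intro mult_left_mono) auto
        moreover have "(A + B + 1) * n < 1/2 * n * n"
          using that nn by (intro mult_strict_right_mono) auto
        ultimately show ?thesis using that nn by (simp add: algebra_simps power2_eq_square)
      qed
      ultimately show ?thesis by (meson not_le)
    qed
    then have "norm z \<le> norm x + 2 * (A + B + 1)" if "\<phi> z \<le> \<phi> y0" for z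
      using that norm_triangle_ineq[of x "z - x"] by fastforce
    then show "bounded {y. \<phi> y \<le> \<phi> y0}"
      unfolding bounded_iff by blast
  next
    show "\<phi> y0 \<noteq> \<infinity>" using dom[OF y0] by simp
    show "\<phi> y \<noteq> - \<infinity>" for y
      by (cases "y \<in> eff_dom g") (simp_all add: dom out)
  qed
  then obtain m where m: "\<And>y. \<phi> m \<le> \<phi> y" by blast
  have "P = arg_min \<phi> (\<lambda>_. True)"
    unfolding P_def prox_def \<phi>_def ..
  moreover have "\<phi> (arg_min \<phi> (\<lambda>_. True)) = \<phi> m"
    by (rule arg_min_equality) (use m in auto)
  ultimately have "\<phi> P \<le> \<phi> y" using m[of y] by simp
  then show ?thesis unfolding \<phi>_def .
qed

lemma prox_in_dom: "prox (\<lambda>y. ereal \<tau> * g y) x \<in> eff_dom g"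
proof -
  obtain y0 where y0: "y0 \<in> eff_dom g" using g_proper unfolding proper_ext_def by auto
  have "ereal \<tau> * g (prox (\<lambda>y. ereal \<tau> * g y) x) \<noteq> \<infinity>"
    using prox_minimizes[of x y0] unfolding g_eq_G[OF y0] by auto
  then show ?thesis
    unfolding in_dom_iff using \<tau>_pos by auto
qed

text \<open>
  The first-order optimality condition. Compare the minimizer \<open>P\<close> with the points
  \<open>(1 - t) P + t z\<close>, use convexity of \<open>g\<close>, divide by \<open>t\<close> and let \<open>t\<close> tend to \<open>0\<close>.
\<close>

lemma prox_variational:
  fixes x z :: 'a
  defines "P \<equiv> prox (\<lambda>y. ereal \<tau> * g y) x"
  assumes z: "z \<in> eff_dom g"
  shows "\<tau> * (G P - G z) \<le> (P - x) \<bullet> (z - P)"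
proof -
  have P: "P \<in> eff_dom g" unfolding P_def by (rule prox_in_dom)
  let ?c = "\<tau> * (G z - G P) + (P - x) \<bullet> (z - P)"
  have "0 \<le> ?c + t / 2 * (norm (z - P))\<^sup>2" if t: "0 < t" "t < 1" for t
  proof -
    let ?y = "(1 - t) *\<^sub>R P + t *\<^sub>R z"
    have y: "?y \<in> eff_dom g" "G ?y \<le> (1 - t) * G P + t * G z"
      using convex_comb_in_dom[OF P z] t by auto
    have "\<tau> * G P + 1/2 * (norm (P - x))\<^sup>2 \<le> \<tau> * G ?y + 1/2 * (norm (?y - x))\<^sup>2"
      using prox_minimizes[of x ?y] g_eq_G[OF P] g_eq_G[OF y(1)] unfolding P_def by simp
    also have "\<dots> \<le> \<tau> * ((1 - t) * G P + t * G z) + 1/2 * (norm (?y - x))\<^sup>2"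
      using y(2) \<tau>_pos by simp
    also have "?y - x = (P - x) + t *\<^sub>R (z - P)"
      by (simp add: algebra_simps)
    also have "(norm ((P - x) + t *\<^sub>R (z - P)))\<^sup>2
        = (norm (P - x))\<^sup>2 + 2 * t * ((P - x) \<bullet> (z - P)) + t\<^sup>2 * (norm (z - P))\<^sup>2"
      unfolding power2_norm_eq_inner by (simp add: inner_add_left inner_add_right inner_commute power2_eq_square algebra_simps)
    finally have "0 \<le> t * (?c + t / 2 * (norm (z - P))\<^sup>2)"
      by (simp add: algebra_simps power2_eq_square)
    then show ?thesis using t by (simp add: zero_le_mult_iff)
  qed
  then have "\<forall>\<^sub>F t in at_right 0. 0 \<le> ?c + t / 2 * (norm (z - P))\<^sup>2"
    unfolding eventually_at_right_field by (intro exI[of _ 1]) auto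
  moreover have "((\<lambda>t. ?c + t / 2 * (norm (z - P))\<^sup>2) \<longlongrightarrow> ?c + 0 / 2 * (norm (z - P))\<^sup>2) (at_right 0)"
    by (intro tendsto_intros) auto
  ultimately have "0 \<le> ?c + 0 / 2 * (norm (z - P))\<^sup>2"
    by (intro tendsto_lowerbound) auto
  then show ?thesis by (simp add: algebra_simps)
qed

text \<open>
  Add the optimality conditions of the two minimizers, each tested at the other one.
  The purpose is continuity, hence measurability, of the proximal map.
\<close>

lemma prox_nonexpansive:
  "norm (prox (\<lambda>y. ereal \<tau> * g y) x - prox (\<lambda>y. ereal \<tau> * g y) x') \<le> norm (x - x')"
    (is "norm (?P - ?P') \<le> _")
proof -
  have "\<tau> * (G ?P - G ?P') \<le> (?P - x) \<bullet> (?P' - ?P)" "\<tau> * (G ?P' - G ?P) \<le> (?P' - x') \<bullet> (?P - ?P')"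
    by (rule prox_variational[OF prox_in_dom])+
  then have "(?P - ?P') \<bullet> (?P - ?P') \<le> (x - x') \<bullet> (?P - ?P')"
    by (simp add: right_diff_distrib inner_diff_left inner_diff_right inner_commute)
  also have "\<dots> \<le> norm (x - x') * norm (?P - ?P')"
    by (rule norm_cauchy_schwarz)
  finally have "norm (?P - ?P') * norm (?P - ?P') \<le> norm (x - x') * norm (?P - ?P')"
    by (simp only: power2_norm_eq_inner[symmetric] power2_eq_square)
  then show ?thesis
    using mult_right_le_imp_le[of "norm (?P - ?P')"] by (cases "?P = ?P'") auto
qed

lemma borel_measurable_prox: "prox (\<lambda>y. ereal \<tau> * g y) \<in> borel_measurable borel"
proof (rule borel_measurable_continuous_onI, rule lipschitz_on_continuous_on)
  show "1-lipschitz_on UNIV (prox (\<lambda>y. ereal \<tau> * g y))"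
    by (rule lipschitz_onI) (simp_all add: dist_norm prox_nonexpansive)
qed

end

section \<open>One iteration: deterministic inequalities\<close>

text \<open>
  One run of the method, together with a solution \<open>zs\<close> that serves as reference point in the
  analysis; the parameter \<open>\<alpha>\<close> is \<open>1 - p\<close> throughout.
\<close>

locale vr_extragradient = stochastic_vi g F Q F\<^sub>\<xi> L
  for g :: "'a::euclidean_space \<Rightarrow> ereal" and F :: "'a \<Rightarrow> 'a" and Q :: "'i measure"
    and F\<^sub>\<xi> :: "'i \<Rightarrow> 'a \<Rightarrow> 'a" and L :: real +
  fixes p \<gamma> :: real and z0 zs :: 'a
  assumes zs_solution: "zs \<in> vi_solutions g F" and z0_dom: "z0 \<in> eff_dom g"
    and p_pos: "0 < p" and p_le_1: "p \<le> 1" and \<gamma>_pos: "0 < \<gamma>" and \<gamma>_less_1: "\<gamma> < 1"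
begin

definition \<tau> :: real where "\<tau> = sqrt p / L * \<gamma>"

lemma zs_dom: "zs \<in> eff_dom g"
  using zs_solution unfolding vi_solutions_def by auto

sublocale minorized_convex g \<tau>
proof
  show "proper_ext g" "convex_ext g" "lsc_ext g" by (rule proper convex lsc)+
  show "0 < \<tau>" unfolding \<tau>_def using p_pos L_pos \<gamma>_pos by simp
  obtain r where r: "g zs = ereal r"
    using proper zs_dom unfolding proper_ext_def eff_dom_def by (cases "g zs") auto
  \<comment> \<open>The variational inequality at \<open>zs\<close> says that \<open>- F zs\<close> is a subgradient of \<open>g\<close> at \<open>zs\<close>.\<close>
  have "ereal ((r + F zs \<bullet> zs) + (- F zs) \<bullet> y) \<le> g y" for y
  proof -
    have "0 \<le> ereal (F zs \<bullet> (y - zs)) + g y - ereal r"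
      using zs_solution r unfolding vi_solutions_def by auto
    then show ?thesis
      by (cases "g y") (auto simp: inner_diff_right algebra_simps)
  qed
  then show "\<exists>a b. \<forall>y. ereal (a + b \<bullet> y) \<le> g y" by blast
qed

text \<open>
  This is what the step size is chosen for: the second moment of a correction, scaled by
  \<open>\<tau>\<^sup>2\<close>, is at most \<open>p \<gamma>\<^sup>2 |h - w|\<^sup>2\<close>, while a step gains \<open>p |h - w|\<^sup>2\<close>.
\<close>

lemma \<tau>_L: "\<tau>\<^sup>2 * L\<^sup>2 = p * \<gamma>\<^sup>2"
  unfolding \<tau>_def using L_pos p_pos by (simp add: power_mult_distrib power_divide)

lemma solution_gap_nonneg:
  assumes "z \<in> eff_dom g"
  shows "0 \<le> F zs \<bullet> (z - zs) + G z - G zs"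
proof -
  have "0 \<le> ereal (F zs \<bullet> (z - zs)) + g z - g zs"
    using zs_solution unfolding vi_solutions_def by auto
  then show ?thesis using assms zs_dom by (simp add: g_eq_G)
qed

definition half :: "'a \<Rightarrow> 'a \<Rightarrow> 'a" where
  "half z w = half_step g F (1 - p) \<tau> z w"

definition full :: "'i \<Rightarrow> 'a \<Rightarrow> 'a \<Rightarrow> 'a" where
  "full i z w = full_step g F F\<^sub>\<xi> (1 - p) \<tau> i z w"

definition snap :: "'i \<times> bool \<Rightarrow> 'a \<Rightarrow> 'a \<Rightarrow> 'a" where
  "snap x z w = (if snd x then full (fst x) z w else w)"

text \<open>
  The variance-reduced estimate of \<open>F (half z w)\<close> is \<open>F w + corr i z w\<close>, and \<open>noise i z w\<close> is its
  error with the sign that makes \<open>F (half z w) = F w + corr i z w + noise i z w\<close>.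
\<close>

definition corr :: "'i \<Rightarrow> 'a \<Rightarrow> 'a \<Rightarrow> 'a" where
  "corr i z w = F\<^sub>\<xi> i (half z w) - F\<^sub>\<xi> i w"

definition noise :: "'i \<Rightarrow> 'a \<Rightarrow> 'a \<Rightarrow> 'a" where
  "noise i z w = F (half z w) - F w - corr i z w"

text \<open>
  The weights are such that, with \<open>n\<close> the next iterate, averaging \<open>\<Phi> v\<close> over the coin of the
  snapshot update leaves \<open>|n - v|\<^sup>2 + (1 - p) |w - v|\<^sup>2\<close>.
\<close>

definition \<Phi> :: "'a \<Rightarrow> 'a \<Rightarrow> 'a \<Rightarrow> real" where
  "\<Phi> v z w = (1 - p) * (norm (z - v))\<^sup>2 + (norm (w - v))\<^sup>2"

lemma \<Phi>_nonneg: "0 \<le> \<Phi> v z w"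
  unfolding \<Phi>_def using p_le_1 by simp

lemma half_dom: "half z w \<in> eff_dom g"
  unfolding half_def half_step_def by (rule prox_in_dom)

lemma full_dom: "full i z w \<in> eff_dom g"
  unfolding full_def full_step_def by (rule prox_in_dom)

lemma snap_dom: "w \<in> eff_dom g \<Longrightarrow> snap x z w \<in> eff_dom g"
  unfolding snap_def by (simp add: full_dom)

text \<open>
  Both inner products are expanded by the cosine rule around the convex combination \<open>zb\<close>; the
  terms \<open>|z - n|\<^sup>2\<close> and \<open>|w - n|\<^sup>2\<close> cancel between them.
\<close>

lemma extragradient_identity:
  fixes z w v n h zb :: 'a
  assumes zb: "zb = (1 - p) *\<^sub>R z + p *\<^sub>R w"
  shows "2 * ((n - zb) \<bullet> (v - n)) + 2 * ((h - zb) \<bullet> (n - h))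
    = (1 - p) * (norm (z - v))\<^sup>2 + p * (norm (w - v))\<^sup>2 - (norm (n - v))\<^sup>2
      - (norm (n - h))\<^sup>2 - (1 - p) * (norm (h - z))\<^sup>2 - p * (norm (h - w))\<^sup>2"
  unfolding zb power2_norm_eq_inner
  by (simp add: inner_add_left inner_add_right inner_diff_left inner_diff_right inner_commute algebra_simps)

text \<open>
  The sum of the optimality condition of the full step, tested at \<open>v\<close>, and of the half step, tested
  at the full step.
\<close>

lemma step_inequality:
  fixes i z w v
  defines "h \<equiv> half z w" and "n \<equiv> full i z w" and "d \<equiv> corr i z w"
  assumes v: "v \<in> eff_dom g"
  shows "2 * \<tau> * ((F w + d) \<bullet> (h - v) + G h - G v) + (norm (n - v))\<^sup>2 + (norm (n - h))\<^sup>2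
    \<le> (1 - p) * (norm (z - v))\<^sup>2 + p * (norm (w - v))\<^sup>2 - p * (norm (h - w))\<^sup>2
      - 2 * \<tau> * (d \<bullet> (n - h))"
proof -
  define zb where "zb = (1 - p) *\<^sub>R z + p *\<^sub>R w"
  have n: "n = prox (\<lambda>y. ereal \<tau> * g y) (zb - \<tau> *\<^sub>R (F w + d))"
    unfolding n_def full_def full_step_def zb_def d_def corr_def half_def by (simp add: algebra_simps)
  have h: "h = prox (\<lambda>y. ereal \<tau> * g y) (zb - \<tau> *\<^sub>R F w)"
    unfolding h_def half_def half_step_def zb_def by simp
  have "\<tau> * (G n - G v) \<le> (n - (zb - \<tau> *\<^sub>R (F w + d))) \<bullet> (v - n)"
    unfolding n by (rule prox_variational[OF v])
  also have "\<dots> = (n - zb) \<bullet> (v - n) + \<tau> * ((F w + d) \<bullet> (v - n))"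
    by (simp add: algebra_simps inner_diff_left inner_diff_right inner_add_left)
  finally have 1: "\<tau> * (G n - G v) \<le> (n - zb) \<bullet> (v - n) + \<tau> * ((F w + d) \<bullet> (v - n))" .
  have "n \<in> eff_dom g" unfolding n_def by (rule full_dom)
  then have "\<tau> * (G h - G n) \<le> (h - (zb - \<tau> *\<^sub>R F w)) \<bullet> (n - h)"
    unfolding h by (rule prox_variational)
  also have "\<dots> = (h - zb) \<bullet> (n - h) + \<tau> * (F w \<bullet> (n - h))"
    by (simp add: algebra_simps inner_diff_left inner_diff_right inner_add_left)
  finally have 2: "\<tau> * (G h - G n) \<le> (h - zb) \<bullet> (n - h) + \<tau> * (F w \<bullet> (n - h))" .
  have 3: "(F w + d) \<bullet> (v - n) + F w \<bullet> (n - h) = - ((F w + d) \<bullet> (h - v)) - d \<bullet> (n - h)"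
    by (simp add: algebra_simps inner_diff_left inner_diff_right inner_add_left)
  have "2 * \<tau> * (G h - G v) = 2 * (\<tau> * (G n - G v)) + 2 * (\<tau> * (G h - G n))"
    by (simp add: algebra_simps)
  also have "\<dots> \<le> 2 * ((n - zb) \<bullet> (v - n)) + 2 * ((h - zb) \<bullet> (n - h))
      + 2 * \<tau> * ((F w + d) \<bullet> (v - n) + F w \<bullet> (n - h))"
    using 1 2 by (simp add: distrib_left)
  also have "\<dots> = ((1 - p) * (norm (z - v))\<^sup>2 + p * (norm (w - v))\<^sup>2 - (norm (n - v))\<^sup>2
      - (norm (n - h))\<^sup>2 - (1 - p) * (norm (h - z))\<^sup>2 - p * (norm (h - w))\<^sup>2)
      + 2 * \<tau> * (- ((F w + d) \<bullet> (h - v)) - d \<bullet> (n - h))"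
    unfolding 3 extragradient_identity[OF zb_def] ..
  finally have "2 * \<tau> * (G h - G v) \<le> \<dots>" .
  moreover have "0 \<le> (1 - p) * (norm (h - z))\<^sup>2" using p_le_1 by simp
  ultimately show ?thesis by (simp add: algebra_simps)
qed

text \<open>
  Two changes to \<open>step_inequality\<close>: Young's inequality with weight \<open>\<gamma>\<close> on the cross term, which
  spends only the fraction \<open>\<gamma>\<close> of \<open>|n - h|\<^sup>2\<close>, and monotonicity, which moves the operator
  from the half step to the comparison point \<open>v\<close>.
\<close>

lemma step_progress:
  fixes i z w v
  defines "h \<equiv> half z w" and "n \<equiv> full i z w" and "d \<equiv> corr i z w" and "e \<equiv> noise i z w"
  assumes v: "v \<in> eff_dom g"
  shows "2 * \<tau> * (F v \<bullet> (h - v) + G h - G v) + (norm (n - v))\<^sup>2 + (1 - \<gamma>) * (norm (n - h))\<^sup>2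
    \<le> (1 - p) * (norm (z - v))\<^sup>2 + p * (norm (w - v))\<^sup>2 - p * (norm (h - w))\<^sup>2
      + \<tau>\<^sup>2 / \<gamma> * (norm d)\<^sup>2 + 2 * \<tau> * (e \<bullet> (h - v))"
proof -
  have "0 \<le> (norm (\<tau> *\<^sub>R d + \<gamma> *\<^sub>R (n - h)))\<^sup>2 / \<gamma>" using \<gamma>_pos by simp
  also have "(norm (\<tau> *\<^sub>R d + \<gamma> *\<^sub>R (n - h)))\<^sup>2
      = \<tau>\<^sup>2 * (norm d)\<^sup>2 + 2 * \<tau> * \<gamma> * (d \<bullet> (n - h)) + \<gamma>\<^sup>2 * (norm (n - h))\<^sup>2"
    unfolding power2_norm_eq_inner
    by (simp add: inner_add_left inner_add_right inner_commute power2_eq_square algebra_simps)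
  also have "\<dots> / \<gamma> = \<tau>\<^sup>2 / \<gamma> * (norm d)\<^sup>2 + 2 * \<tau> * (d \<bullet> (n - h)) + \<gamma> * (norm (n - h))\<^sup>2"
    using \<gamma>_pos by (simp add: field_simps power2_eq_square)
  finally have young: "- 2 * \<tau> * (d \<bullet> (n - h)) \<le> \<tau>\<^sup>2 / \<gamma> * (norm d)\<^sup>2 + \<gamma> * (norm (n - h))\<^sup>2" by simp
  have "F v \<bullet> (h - v) \<le> F h \<bullet> (h - v)"
    using monotone[of h v] half_dom v unfolding h_def by (simp add: inner_diff_left)
  also have "F h = F w + d + e" unfolding e_def noise_def d_def h_def by simp
  finally have "F v \<bullet> (h - v) \<le> (F w + d) \<bullet> (h - v) + e \<bullet> (h - v)"
    by (simp add: inner_add_left)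
  then have "2 * \<tau> * (F v \<bullet> (h - v)) \<le> 2 * \<tau> * ((F w + d) \<bullet> (h - v) + e \<bullet> (h - v))"
    using \<tau>_pos by (intro mult_left_mono) auto
  with step_inequality[OF v, of w i z] young show ?thesis
    unfolding h_def[symmetric] n_def[symmetric] d_def[symmetric] by (simp add: algebra_simps)
qed

text \<open>
  The error of one iteration in the telescoping inequality for \<open>\<Phi> v\<close>, split into its part at
  \<open>v = zs\<close> and its linear dependence on \<open>v - zs\<close>. The snapshot contributes
  \<open>|w' - v|\<^sup>2 - p |n - v|\<^sup>2 - (1 - p) |w - v|\<^sup>2\<close>, whose quadratic terms in \<open>v\<close> cancel since the
  weights sum to \<open>0\<close>. The mean of \<open>drift\<close> vanishes, and that of \<open>incr\<close> is the mean of its first term.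
\<close>

definition incr :: "'i \<times> bool \<Rightarrow> 'a \<Rightarrow> 'a \<Rightarrow> real" where
  "incr x z w = \<tau>\<^sup>2 / \<gamma> * (norm (corr (fst x) z w))\<^sup>2
     + 2 * \<tau> * (noise (fst x) z w \<bullet> (half z w - zs))
     + ((norm (snap x z w - zs))\<^sup>2 - p * (norm (full (fst x) z w - zs))\<^sup>2 - (1 - p) * (norm (w - zs))\<^sup>2)"

definition drift :: "'i \<times> bool \<Rightarrow> 'a \<Rightarrow> 'a \<Rightarrow> 'a" where
  "drift x z w = (2 * \<tau>) *\<^sub>R noise (fst x) z w
     + 2 *\<^sub>R (snap x z w - p *\<^sub>R full (fst x) z w - (1 - p) *\<^sub>R w)"

lemma telescoping_step:
  assumes v: "v \<in> eff_dom g"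
  shows "2 * \<tau> * (F v \<bullet> (half z w - v) + G (half z w) - G v) + \<Phi> v (full (fst x) z w) (snap x z w)
    \<le> \<Phi> v z w + incr x z w - drift x z w \<bullet> (v - zs)"
proof -
  let ?h = "half z w" and ?n = "full (fst x) z w" and ?e = "noise (fst x) z w" and ?s = "snap x z w"
  have bracket: "(norm (?s - v))\<^sup>2 - p * (norm (?n - v))\<^sup>2 - (1 - p) * (norm (w - v))\<^sup>2
    = (norm (?s - zs))\<^sup>2 - p * (norm (?n - zs))\<^sup>2 - (1 - p) * (norm (w - zs))\<^sup>2
      - 2 * ((?s - p *\<^sub>R ?n - (1 - p) *\<^sub>R w) \<bullet> (v - zs))"
    unfolding power2_norm_eq_inner
    by (simp add: inner_add_left inner_add_right inner_diff_left inner_diff_right inner_commute algebra_simps)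
  have split: "?e \<bullet> (?h - v) = ?e \<bullet> (?h - zs) - ?e \<bullet> (v - zs)"
    by (simp add: inner_diff_right)
  have "0 \<le> (1 - \<gamma>) * (norm (?n - ?h))\<^sup>2" "0 \<le> p * (norm (?h - w))\<^sup>2"
    using \<gamma>_less_1 p_pos by simp_all
  then have "2 * \<tau> * (F v \<bullet> (?h - v) + G ?h - G v) + (norm (?n - v))\<^sup>2
    \<le> (1 - p) * (norm (z - v))\<^sup>2 + p * (norm (w - v))\<^sup>2
      + \<tau>\<^sup>2 / \<gamma> * (norm (corr (fst x) z w))\<^sup>2 + 2 * \<tau> * (?e \<bullet> (?h - v))"
    using step_progress[OF v, of z w "fst x"] by linarith
  moreover have "drift x z w \<bullet> (v - zs)
    = 2 * \<tau> * (?e \<bullet> (v - zs)) + 2 * ((?s - p *\<^sub>R ?n - (1 - p) *\<^sub>R w) \<bullet> (v - zs))"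
    unfolding drift_def by (simp add: inner_add_left)
  ultimately show ?thesis
    using bracket unfolding \<Phi>_def incr_def split by (simp add: algebra_simps)
qed

text \<open>
  At \<open>v = zs\<close> the gap term is nonnegative and the linear term vanishes, so a number that
  dominates \<open>\<Phi> zs\<close> still does so after adding \<open>incr\<close>, for every outcome of the draw.
\<close>

lemma incr_keeps_domination:
  assumes "\<Phi> zs z w \<le> U"
  shows "\<Phi> zs (full (fst x) z w) (snap x z w) \<le> U + incr x z w"
proof -
  have "0 \<le> 2 * \<tau> * (F zs \<bullet> (half z w - zs) + G (half z w) - G zs)"
    using solution_gap_nonneg[OF half_dom] \<tau>_pos by simp
  with telescoping_step[OF zs_dom, of z w x] assms show ?thesis by simp
qed

text \<open>
  The constant \<open>7\<close> is an upper bound for \<open>\<gamma> + 2 \<gamma>\<^sup>2 + 4\<close>, the total size of the errors that the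
  decrease of \<open>\<Phi> zs\<close> has to pay for in \<open>potential_next_mean\<close>.
\<close>

definition weight :: real where "weight = 7 / (1 - \<gamma>)"

lemma weight_bound: "7 = weight * (1 - \<gamma>)"
  using weight_def \<gamma>_less_1 by (simp only: eq_divide_eq)

lemma weight_pos: "0 < weight"
  unfolding weight_def using \<gamma>_less_1 by simp

text \<open>
  Here \<open>U\<close> stands for the accumulated \<open>incr\<close> and \<open>M\<close> for the accumulated \<open>drift\<close>.
\<close>

definition potential :: "real \<Rightarrow> 'a \<Rightarrow> 'a \<Rightarrow> 'a \<Rightarrow> real" where
  "potential U M z w = U + 1/2 * (norm M)\<^sup>2 + weight * \<Phi> zs z w"

definition potential_next :: "real \<Rightarrow> 'a \<Rightarrow> 'a \<Rightarrow> 'a \<Rightarrow> 'i \<times> bool \<Rightarrow> real" where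
  "potential_next U M z w x
    = potential (U + incr x z w) (M + drift x z w) (full (fst x) z w) (snap x z w)"

lemma potential_next_nonneg:
  assumes "\<Phi> zs z w \<le> U"
  shows "0 \<le> potential_next U M z w x"
proof -
  have "0 \<le> U + incr x z w"
    using incr_keeps_domination[OF assms, of x] \<Phi>_nonneg order_trans by blast
  then show ?thesis
    unfolding potential_next_def potential_def using weight_pos \<Phi>_nonneg by simp
qed

text \<open>
  The coin is averaged first, for a fixed index. Then the snapshot part of \<open>incr\<close> vanishes and
  that of \<open>drift\<close> leaves only its variance \<open>p (1 - p) |n - w|\<^sup>2\<close>, which is paid for by the
  decrease of \<open>\<Phi> zs\<close>. The right-hand side no longer contains the full step: it
  is a quadratic expression in the correction, so that only the moments of the oracle are left to
  compute.
\<close>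

lemma coin_average:
  fixes i z w U M
  defines "h \<equiv> half z w" and "d \<equiv> corr i z w" and "e \<equiv> noise i z w"
  shows "p * potential_next U M z w (i, True) + (1 - p) * potential_next U M z w (i, False)
    \<le> potential U M z w + (1 + weight) * (\<tau>\<^sup>2 / \<gamma> * (norm d)\<^sup>2 + 2 * \<tau> * (e \<bullet> (h - zs)))
      + 2 * \<tau> * (e \<bullet> M) + 2 * \<tau>\<^sup>2 * (norm e)\<^sup>2 - (weight - 4) * p * (norm (h - w))\<^sup>2"
proof -
  define n where "n = full i z w"
  \<comment> \<open>The snapshot part of \<open>incr\<close> averages to \<open>0\<close>; that of \<open>drift\<close> is centred, so its cross
    term with \<open>M + 2 \<tau> e\<close> vanishes as well.\<close>
  have avg: "p * potential_next U M z w (i, True) + (1 - p) * potential_next U M z w (i, False)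
    = U + \<tau>\<^sup>2 / \<gamma> * (norm d)\<^sup>2 + 2 * \<tau> * (e \<bullet> (h - zs))
      + 1/2 * (norm M)\<^sup>2 + 2 * \<tau> * (e \<bullet> M) + 2 * \<tau>\<^sup>2 * (norm e)\<^sup>2 + 2 * (p * (1 - p)) * (norm (n - w))\<^sup>2
      + weight * ((norm (n - zs))\<^sup>2 + (1 - p) * (norm (w - zs))\<^sup>2)"
    unfolding potential_next_def potential_def \<Phi>_def incr_def drift_def snap_def
      fst_conv snd_conv if_True if_False n_def[symmetric] h_def[symmetric] d_def[symmetric]
      e_def[symmetric] power2_norm_eq_inner
    by (simp add: inner_add_left inner_add_right inner_diff_left inner_diff_right inner_commute
        power2_eq_square algebra_simps add_divide_distrib diff_divide_distrib)
  have "0 \<le> 2 * \<tau> * (F zs \<bullet> (h - zs) + G h - G zs)"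
    unfolding h_def using solution_gap_nonneg[OF half_dom] \<tau>_pos by simp
  then have prog: "(norm (n - zs))\<^sup>2 \<le> (1 - p) * (norm (z - zs))\<^sup>2 + p * (norm (w - zs))\<^sup>2
      - (1 - \<gamma>) * (norm (n - h))\<^sup>2 - p * (norm (h - w))\<^sup>2
      + \<tau>\<^sup>2 / \<gamma> * (norm d)\<^sup>2 + 2 * \<tau> * (e \<bullet> (h - zs))"
    using step_progress[OF zs_dom, of z w i]
    unfolding h_def[symmetric] n_def[symmetric] d_def[symmetric] e_def[symmetric] by simp
  have "weight * (norm (n - zs))\<^sup>2 \<le> weight * ((1 - p) * (norm (z - zs))\<^sup>2 + p * (norm (w - zs))\<^sup>2
      - (1 - \<gamma>) * (norm (n - h))\<^sup>2 - p * (norm (h - w))\<^sup>2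
      + \<tau>\<^sup>2 / \<gamma> * (norm d)\<^sup>2 + 2 * \<tau> * (e \<bullet> (h - zs)))"
    using weight_pos by (intro mult_left_mono[OF prog]) auto
  also have "\<dots> = weight * ((1 - p) * (norm (z - zs))\<^sup>2 + p * (norm (w - zs))\<^sup>2)
      - 7 * (norm (n - h))\<^sup>2 - weight * p * (norm (h - w))\<^sup>2
      + weight * (\<tau>\<^sup>2 / \<gamma> * (norm d)\<^sup>2 + 2 * \<tau> * (e \<bullet> (h - zs)))"
    unfolding weight_bound by (simp only: algebra_simps)
  finally have contraction: "weight * (norm (n - zs))\<^sup>2 \<le> \<dots>" .
  have "(norm (n - w))\<^sup>2 \<le> 2 * (norm (n - h))\<^sup>2 + 2 * (norm (h - w))\<^sup>2"
  proof -
    have "0 \<le> (norm ((n - h) - (h - w)))\<^sup>2" by simp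
    then show ?thesis
      unfolding power2_norm_eq_inner
      by (simp add: inner_add_left inner_add_right inner_diff_left inner_diff_right inner_commute algebra_simps)
  qed
  then have "2 * p * (norm (n - w))\<^sup>2 \<le> 2 * p * (2 * (norm (n - h))\<^sup>2 + 2 * (norm (h - w))\<^sup>2)"
    using p_pos by (intro mult_left_mono) auto
  moreover have "2 * (p * (1 - p)) * (norm (n - w))\<^sup>2 \<le> 2 * p * (norm (n - w))\<^sup>2"
    using p_pos by (intro mult_right_mono) auto
  moreover have "4 * p * (norm (n - h))\<^sup>2 \<le> 7 * (norm (n - h))\<^sup>2"
    using p_le_1 by (intro mult_right_mono) auto
  ultimately have "2 * (p * (1 - p)) * (norm (n - w))\<^sup>2 \<le> 7 * (norm (n - h))\<^sup>2 + 4 * p * (norm (h - w))\<^sup>2"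
    by (simp add: distrib_left mult.assoc)
  with contraction show ?thesis
    unfolding avg by (simp add: potential_def \<Phi>_def algebra_simps add_divide_distrib)
qed

end

section \<open>One iteration: measurability and expectation\<close>

context vr_extragradient
begin

text \<open>
  On the domain of \<open>g\<close> the operator is a parameter integral of the jointly measurable oracle.
  Outside of it \<open>F\<close> is arbitrary, which is why measurability is stated for compositions with
  functions whose values lie in the domain.
\<close>

lemma borel_measurable_operator:
  assumes [measurable]: "X \<in> borel_measurable M" and dom: "\<And>\<omega>. \<omega> \<in> space M \<Longrightarrow> X \<omega> \<in> eff_dom g"
  shows "(\<lambda>\<omega>. F (X \<omega>)) \<in> borel_measurable M"
proof -
  interpret Q: prob_space Q by (rule prob_Q)
  have [measurable]: "(\<lambda>(z, i). F\<^sub>\<xi> i z) \<in> borel_measurable (borel \<Otimes>\<^sub>M Q)"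
    using measurable_compose[OF measurable_pair_swap' oracle_measurable] by (simp add: case_prod_beta')
  have "(\<lambda>z. \<integral>i. F\<^sub>\<xi> i z \<partial>Q) \<in> borel_measurable borel"
    by measurable
  then have "(\<lambda>\<omega>. \<integral>i. F\<^sub>\<xi> i (X \<omega>) \<partial>Q) \<in> borel_measurable M"
    by (rule measurable_compose[OF assms(1)])
  then show ?thesis
    by (rule measurable_cong[THEN iffD1, rotated]) (simp add: unbiased dom)
qed

lemma borel_measurable_oracle:
  assumes "I \<in> measurable M Q" "X \<in> borel_measurable M"
  shows "(\<lambda>\<omega>. F\<^sub>\<xi> (I \<omega>) (X \<omega>)) \<in> borel_measurable M"
  using measurable_compose[OF measurable_Pair[OF assms] oracle_measurable] by simp

lemma borel_measurable_half:
  assumes [measurable]: "Z \<in> borel_measurable M" "W \<in> borel_measurable M"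
    and dom: "\<And>\<omega>. \<omega> \<in> space M \<Longrightarrow> W \<omega> \<in> eff_dom g"
  shows "(\<lambda>\<omega>. half (Z \<omega>) (W \<omega>)) \<in> borel_measurable M"
proof -
  note borel_measurable_operator[OF assms(2) dom, measurable] borel_measurable_prox[measurable]
  show ?thesis unfolding half_def half_step_def by measurable
qed

context
  fixes M :: "'w measure" and Z W :: "'w \<Rightarrow> 'a" and X :: "'w \<Rightarrow> 'i \<times> bool"
  assumes Z[measurable]: "Z \<in> borel_measurable M" and W[measurable]: "W \<in> borel_measurable M"
    and X[measurable]: "X \<in> measurable M (Q \<Otimes>\<^sub>M measure_pmf (bernoulli_pmf p))"
    and W_dom: "\<And>\<omega>. \<omega> \<in> space M \<Longrightarrow> W \<omega> \<in> eff_dom g"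
begin

lemma index_coin_measurable[measurable]:
  "(\<lambda>\<omega>. fst (X \<omega>)) \<in> measurable M Q" "Measurable.pred M (\<lambda>\<omega>. snd (X \<omega>))"
proof -
  show "(\<lambda>\<omega>. fst (X \<omega>)) \<in> measurable M Q" by measurable
  have "(\<lambda>\<omega>. snd (X \<omega>)) \<in> measurable M (measure_pmf (bernoulli_pmf p))" by measurable
  then show "Measurable.pred M (\<lambda>\<omega>. snd (X \<omega>))" by simp
qed

lemma borel_measurable_F_half: "(\<lambda>\<omega>. F (half (Z \<omega>) (W \<omega>))) \<in> borel_measurable M"
  by (intro borel_measurable_operator borel_measurable_half Z W W_dom half_dom)

lemma borel_measurable_corr: "(\<lambda>\<omega>. corr (fst (X \<omega>)) (Z \<omega>) (W \<omega>)) \<in> borel_measurable M"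
  unfolding corr_def
  by (intro borel_measurable_diff borel_measurable_oracle borel_measurable_half Z W W_dom index_coin_measurable)

lemma borel_measurable_full: "(\<lambda>\<omega>. full (fst (X \<omega>)) (Z \<omega>) (W \<omega>)) \<in> borel_measurable M"
proof -
  note borel_measurable_operator[OF W W_dom, measurable] borel_measurable_prox[measurable]
    borel_measurable_oracle[OF index_coin_measurable(1) W, measurable]
    borel_measurable_oracle[OF index_coin_measurable(1) borel_measurable_half[OF Z W W_dom], measurable]
  show ?thesis unfolding full_def full_step_def half_def[symmetric] by measurable
qed

lemma borel_measurable_snap: "(\<lambda>\<omega>. snap (X \<omega>) (Z \<omega>) (W \<omega>)) \<in> borel_measurable M"
  unfolding snap_def using borel_measurable_full by measurable

lemma borel_measurable_noise: "(\<lambda>\<omega>. noise (fst (X \<omega>)) (Z \<omega>) (W \<omega>)) \<in> borel_measurable M"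
  unfolding noise_def
  by (intro borel_measurable_diff borel_measurable_F_half borel_measurable_corr borel_measurable_operator W W_dom)

lemma borel_measurable_incr: "(\<lambda>\<omega>. incr (X \<omega>) (Z \<omega>) (W \<omega>)) \<in> borel_measurable M"
proof -
  note [measurable] = borel_measurable_corr borel_measurable_noise borel_measurable_full
    borel_measurable_snap borel_measurable_half[OF Z W W_dom]
  show ?thesis unfolding incr_def by measurable
qed

lemma borel_measurable_drift: "(\<lambda>\<omega>. drift (X \<omega>) (Z \<omega>) (W \<omega>)) \<in> borel_measurable M"
proof -
  note [measurable] = borel_measurable_noise borel_measurable_full borel_measurable_snap
  show ?thesis unfolding drift_def by measurable
qed

lemma borel_measurable_potential_next:
  assumes [measurable]: "U \<in> borel_measurable M" "D \<in> borel_measurable M"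
  shows "(\<lambda>\<omega>. potential_next (U \<omega>) (D \<omega>) (Z \<omega>) (W \<omega>) (X \<omega>)) \<in> borel_measurable M"
proof -
  note [measurable] = borel_measurable_incr borel_measurable_drift borel_measurable_full
    borel_measurable_snap
  show ?thesis unfolding potential_next_def potential_def \<Phi>_def by measurable
qed

end

text \<open>
  Unbiasedness and the Lipschitz condition in mean at \<open>half z w\<close> and \<open>w\<close>, which both lie in the
  domain.
\<close>

lemma corr_moments:
  assumes w: "w \<in> eff_dom g"
  shows integrable_corr: "integrable Q (\<lambda>i. corr i z w)"
    and integral_corr: "(\<integral>i. corr i z w \<partial>Q) = F (half z w) - F w"
    and integrable_corr_square: "integrable Q (\<lambda>i. (norm (corr i z w))\<^sup>2)"
    and second_moment_corr: "(\<integral>i. (norm (corr i z w))\<^sup>2 \<partial>Q) \<le> L\<^sup>2 * (norm (half z w - w))\<^sup>2"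
proof -
  interpret Q: prob_space Q by (rule prob_Q)
  note int = oracle_integrable[OF half_dom] oracle_integrable[OF w]
  show i: "integrable Q (\<lambda>i. corr i z w)"
    unfolding corr_def by (intro Bochner_Integration.integrable_diff int)
  show "(\<integral>i. corr i z w \<partial>Q) = F (half z w) - F w"
    unfolding corr_def by (simp add: int unbiased[OF half_dom] unbiased[OF w])
  have le: "(\<integral>\<^sup>+i. ennreal ((norm (corr i z w))\<^sup>2) \<partial>Q) \<le> ennreal (L\<^sup>2 * (norm (half z w - w))\<^sup>2)"
    unfolding corr_def by (rule lipschitz_in_mean)
  have [measurable]: "(\<lambda>i. corr i z w) \<in> borel_measurable Q" using i by auto
  show sq: "integrable Q (\<lambda>i. (norm (corr i z w))\<^sup>2)"
  proof (rule integrableI_bounded)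
    show "(\<integral>\<^sup>+i. ennreal (norm ((norm (corr i z w))\<^sup>2)) \<partial>Q) < \<infinity>"
      using le by (simp add: le_less_trans)
  qed measurable
  have "ennreal (\<integral>i. (norm (corr i z w))\<^sup>2 \<partial>Q) \<le> ennreal (L\<^sup>2 * (norm (half z w - w))\<^sup>2)"
    using le by (subst nn_integral_eq_integral[OF sq, symmetric]) auto
  then show "(\<integral>i. (norm (corr i z w))\<^sup>2 \<partial>Q) \<le> L\<^sup>2 * (norm (half z w - w))\<^sup>2"
    by (subst (asm) ennreal_le_iff) auto
qed

text \<open>
  The noise is the centred correction up to sign, and centring does not increase the second moment.
\<close>

lemma noise_moments:
  assumes w: "w \<in> eff_dom g"
  shows integrable_noise_inner: "integrable Q (\<lambda>i. noise i z w \<bullet> c)"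
    and integral_noise_inner: "(\<integral>i. noise i z w \<bullet> c \<partial>Q) = 0"
    and integrable_noise_square: "integrable Q (\<lambda>i. (norm (noise i z w))\<^sup>2)"
    and second_moment_noise: "(\<integral>i. (norm (noise i z w))\<^sup>2 \<partial>Q) \<le> L\<^sup>2 * (norm (half z w - w))\<^sup>2"
proof -
  interpret Q: prob_space Q by (rule prob_Q)
  define m where "m = F (half z w) - F w"
  have noise: "noise i z w = m - corr i z w" for i unfolding noise_def m_def ..
  note [simp] = integrable_corr[OF w, of z] integrable_corr_square[OF w, of z]
  have int_noise: "integrable Q (\<lambda>i. noise i z w)" unfolding noise by simp
  then show "integrable Q (\<lambda>i. noise i z w \<bullet> c)" by simp
  have "(\<integral>i. noise i z w \<partial>Q) = 0"
    unfolding noise using integral_corr[OF w, of z] by (simp add: m_def Q.prob_space)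
  then show "(\<integral>i. noise i z w \<bullet> c \<partial>Q) = 0"
    using int_noise by simp
  have sq: "(norm (noise i z w))\<^sup>2 = (norm m)\<^sup>2 - 2 * (corr i z w \<bullet> m) + (norm (corr i z w))\<^sup>2" for i
    unfolding noise power2_norm_eq_inner by (simp add: inner_diff_left inner_diff_right inner_commute)
  show "integrable Q (\<lambda>i. (norm (noise i z w))\<^sup>2)"
    unfolding sq by simp
  have "(\<integral>i. (norm (noise i z w))\<^sup>2 \<partial>Q)
      = (norm m)\<^sup>2 - 2 * ((\<integral>i. corr i z w \<partial>Q) \<bullet> m) + (\<integral>i. (norm (corr i z w))\<^sup>2 \<partial>Q)"
    unfolding sq by (simp add: Q.prob_space)
  also have "\<dots> = (\<integral>i. (norm (corr i z w))\<^sup>2 \<partial>Q) - (norm m)\<^sup>2"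
    unfolding integral_corr[OF w] by (simp add: m_def power2_norm_eq_inner)
  also have "\<dots> \<le> L\<^sup>2 * (norm (half z w - w))\<^sup>2"
    using second_moment_corr[OF w, of z] zero_le_power2[of "norm m"] by linarith
  finally show "(\<integral>i. (norm (noise i z w))\<^sup>2 \<partial>Q) \<le> L\<^sup>2 * (norm (half z w - w))\<^sup>2" .
qed

text \<open>
  The supermartingale step. After averaging over the coin, the terms linear in the noise have mean
  \<open>0\<close>, and the quadratic ones are at most a multiple of \<open>p |h - w|\<^sup>2\<close> by \<open>\<tau>_L\<close>; the weight is
  chosen so that the total coefficient of \<open>p |h - w|\<^sup>2\<close> is not positive.
\<close>

lemma potential_next_mean:
  assumes w: "w \<in> eff_dom g" and U: "\<Phi> zs z w \<le> U"
  shows "(\<integral>\<^sup>+x. ennreal (potential_next U M z w x) \<partial>(Q \<Otimes>\<^sub>M measure_pmf (bernoulli_pmf p))) \<le> ennreal (potential U M z w)"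
proof -
  interpret Q: prob_space Q by (rule prob_Q)
  define h where "h = half z w"
  define b where "b = (\<lambda>i. potential U M z w
      + (1 + weight) * (\<tau>\<^sup>2 / \<gamma> * (norm (corr i z w))\<^sup>2 + 2 * \<tau> * (noise i z w \<bullet> (h - zs)))
      + 2 * \<tau> * (noise i z w \<bullet> M) + 2 * \<tau>\<^sup>2 * (norm (noise i z w))\<^sup>2
      - (weight - 4) * p * (norm (h - w))\<^sup>2)"
  let ?avg = "\<lambda>i. p * potential_next U M z w (i, True) + (1 - p) * potential_next U M z w (i, False)"
  have avg_nonneg: "0 \<le> ?avg i" for i
    using potential_next_nonneg[OF U] p_pos p_le_1 by simp
  have avg_le: "?avg i \<le> b i" for i
    unfolding b_def h_def by (rule coin_average)
  note int = integrable_corr_square[OF w, of z] integrable_noise_inner[OF w, of z]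
    integrable_noise_square[OF w, of z]
  have int_b: "integrable Q b"
    unfolding b_def by (simp add: int)
  have "(\<integral>i. b i \<partial>Q) = potential U M z w + (1 + weight) * (\<tau>\<^sup>2 / \<gamma> * (\<integral>i. (norm (corr i z w))\<^sup>2 \<partial>Q))
      + 2 * \<tau>\<^sup>2 * (\<integral>i. (norm (noise i z w))\<^sup>2 \<partial>Q) - (weight - 4) * p * (norm (h - w))\<^sup>2"
    unfolding b_def by (simp add: int integral_noise_inner[OF w] Q.prob_space)
  also have "\<dots> \<le> potential U M z w + (1 + weight) * (\<tau>\<^sup>2 / \<gamma> * (L\<^sup>2 * (norm (h - w))\<^sup>2))
      + 2 * \<tau>\<^sup>2 * (L\<^sup>2 * (norm (h - w))\<^sup>2) - (weight - 4) * p * (norm (h - w))\<^sup>2"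
    unfolding h_def using weight_pos \<gamma>_pos second_moment_corr[OF w, of z] second_moment_noise[OF w, of z]
    by (intro diff_right_mono add_mono mult_left_mono) auto
  also have "\<dots> = potential U M z w + ((1 + weight) * (\<tau>\<^sup>2 * L\<^sup>2 / \<gamma>) + 2 * (\<tau>\<^sup>2 * L\<^sup>2) - (weight - 4) * p) * (norm (h - w))\<^sup>2"
    by (simp add: algebra_simps)
  also have "(1 + weight) * (\<tau>\<^sup>2 * L\<^sup>2 / \<gamma>) + 2 * (\<tau>\<^sup>2 * L\<^sup>2) - (weight - 4) * p
      = p * (\<gamma> + 2 * \<gamma>\<^sup>2 + 4 - weight * (1 - \<gamma>))"
    unfolding \<tau>_L using \<gamma>_pos by (simp add: field_simps power2_eq_square)
  also have "potential U M z w + p * (\<gamma> + 2 * \<gamma>\<^sup>2 + 4 - weight * (1 - \<gamma>)) * (norm (h - w))\<^sup>2 \<le> potential U M z w"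
  proof -
    have "\<gamma>\<^sup>2 \<le> 1" using \<gamma>_pos \<gamma>_less_1 by (simp add: power_le_one)
    then have "\<gamma> + 2 * \<gamma>\<^sup>2 + 4 - weight * (1 - \<gamma>) \<le> 0"
      unfolding weight_bound[symmetric] using \<gamma>_less_1 by simp
    then have "p * (\<gamma> + 2 * \<gamma>\<^sup>2 + 4 - weight * (1 - \<gamma>)) * (norm (h - w))\<^sup>2 \<le> 0"
      using p_pos by (simp add: mult_le_0_iff)
    then show ?thesis by simp
  qed
  finally have b_mean: "(\<integral>i. b i \<partial>Q) \<le> potential U M z w" .
  have [measurable]: "potential_next U M z w \<in> borel_measurable (Q \<Otimes>\<^sub>M measure_pmf (bernoulli_pmf p))"
    using borel_measurable_potential_next[of "\<lambda>_. z" "Q \<Otimes>\<^sub>M measure_pmf (bernoulli_pmf p)" "\<lambda>_. w" "\<lambda>x. x" "\<lambda>_. U" "\<lambda>_. M"] w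
    by simp
  have "(\<integral>\<^sup>+x. ennreal (potential_next U M z w x) \<partial>(Q \<Otimes>\<^sub>M measure_pmf (bernoulli_pmf p)))
      = (\<integral>\<^sup>+i. (\<integral>\<^sup>+c. ennreal (potential_next U M z w (i, c)) \<partial>measure_pmf (bernoulli_pmf p)) \<partial>Q)"
    by (rule measure_pmf.nn_integral_fst[symmetric]) measurable
  also have "\<dots> = (\<integral>\<^sup>+i. ennreal (?avg i) \<partial>Q)"
    using p_pos p_le_1 potential_next_nonneg[OF U]
    by (intro nn_integral_cong) (simp add: ennreal_mult ennreal_plus ac_simps)
  also have "\<dots> \<le> (\<integral>\<^sup>+i. ennreal (b i) \<partial>Q)"
    using avg_le by (intro nn_integral_mono ennreal_leI)
  also have "\<dots> = ennreal (\<integral>i. b i \<partial>Q)"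
    using avg_le avg_nonneg order_trans by (intro nn_integral_eq_integral int_b) blast
  also have "\<dots> \<le> ennreal (potential U M z w)"
    by (rule ennreal_leI[OF b_mean])
  finally show ?thesis .
qed

end

section \<open>Independent draws and extended expectations\<close>

text \<open>
  Draw \<open>k\<close> is independent of the draws before it. A sequence has the same law as one that follows a
  first sequence up to time \<open>k\<close> and an independent copy from then on; a function of the
  past sees the first sequence only, and draw \<open>k\<close> is the initial draw of the copy.
\<close>

lemma nn_integral_draw_independent_of_past:
  assumes "prob_space M"
    and h[measurable]: "h \<in> borel_measurable ((\<Pi>\<^sub>M i\<in>(UNIV::nat set). M) \<Otimes>\<^sub>M M)"
    and past: "\<And>\<omega> \<omega>' x. (\<And>j. j < k \<Longrightarrow> \<omega> j = \<omega>' j) \<Longrightarrow> h (\<omega>, x) = h (\<omega>', x)"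
  shows "(\<integral>\<^sup>+\<omega>. h (\<omega>, \<omega> k) \<partial>(\<Pi>\<^sub>M i\<in>UNIV. M)) = (\<integral>\<^sup>+\<omega>. (\<integral>\<^sup>+x. h (\<omega>, x) \<partial>M) \<partial>(\<Pi>\<^sub>M i\<in>UNIV. M))"
proof -
  interpret M: prob_space M by fact
  interpret sequence_space M
    by (simp add: sequence_space_def product_prob_space_def product_prob_space_axioms_def
        product_sigma_finite_def M.prob_space_axioms M.sigma_finite_measure_axioms)
  have "(\<integral>\<^sup>+\<omega>. h (\<omega>, \<omega> k) \<partial>S)
      = (\<integral>\<^sup>+\<omega>. h (\<omega>, \<omega> k) \<partial>distr (S \<Otimes>\<^sub>M S) S (\<lambda>(\<omega>, \<omega>'). comb_seq k \<omega> \<omega>'))"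
    unfolding PiM_comb_seq ..
  also have "\<dots> = (\<integral>\<^sup>+u. h (comb_seq k (fst u) (snd u), comb_seq k (fst u) (snd u) k) \<partial>(S \<Otimes>\<^sub>M S))"
    by (subst nn_integral_distr) (auto simp: case_prod_beta')
  also have "\<dots> = (\<integral>\<^sup>+u. h (fst u, snd u 0) \<partial>(S \<Otimes>\<^sub>M S))"
  proof (intro nn_integral_cong)
    fix u :: "(nat \<Rightarrow> 'a) \<times> (nat \<Rightarrow> 'a)"
    have "h (comb_seq k (fst u) (snd u), snd u 0) = h (fst u, snd u 0)"
      by (rule past) (simp add: comb_seq_less)
    then show "h (comb_seq k (fst u) (snd u), comb_seq k (fst u) (snd u) k) = h (fst u, snd u 0)"
      using comb_seq_add[of k "fst u" "snd u" 0] by simp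
  qed
  also have "\<dots> = (\<integral>\<^sup>+\<omega>. (\<integral>\<^sup>+\<omega>'. h (\<omega>, \<omega>' 0) \<partial>S) \<partial>S)"
    by (subst nn_integral_fst[symmetric]) auto
  also have "\<dots> = (\<integral>\<^sup>+\<omega>. (\<integral>\<^sup>+x. h (\<omega>, x) \<partial>M) \<partial>S)"
  proof (intro nn_integral_cong)
    fix \<omega> assume [simp]: "\<omega> \<in> space S"
    have "(\<integral>\<^sup>+\<omega>'. h (\<omega>, \<omega>' 0) \<partial>S) = (\<integral>\<^sup>+x. h (\<omega>, x) \<partial>distr S M (\<lambda>\<omega>'. \<omega>' 0))"
      by (subst nn_integral_distr) auto
    also have "distr S M (\<lambda>\<omega>'. \<omega>' 0) = M"
      by (rule distr_PiM_component) (auto intro: M.prob_space_axioms)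
    finally show "(\<integral>\<^sup>+\<omega>'. h (\<omega>, \<omega>' 0) \<partial>S) = (\<integral>\<^sup>+x. h (\<omega>, x) \<partial>M)" .
  qed
  finally show ?thesis .
qed

text \<open>
  The negative part of \<open>X\<close> can only lower the expectation, so a bound on the positive part suffices.
\<close>

lemma ext_expectation_le:
  assumes "\<And>\<omega>. \<omega> \<in> space M \<Longrightarrow> X \<omega> \<le> ereal (B \<omega>)"
    and "(\<integral>\<^sup>+\<omega>. ennreal (B \<omega>) \<partial>M) \<le> ennreal c" and "0 \<le> c"
  shows "ext_expectation M X \<le> ereal c"
proof -
  have "(\<integral>\<^sup>+\<omega>. e2ennreal (X \<omega>) \<partial>M) \<le> (\<integral>\<^sup>+\<omega>. ennreal (B \<omega>) \<partial>M)"
    using assms(1) by (intro nn_integral_mono) (metis e2ennreal_mono e2ennreal_ereal)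
  also have "\<dots> \<le> ennreal c" by fact
  finally have "enn2ereal (\<integral>\<^sup>+\<omega>. e2ennreal (X \<omega>) \<partial>M) \<le> enn2ereal (ennreal c)"
    by (simp add: less_eq_ennreal.rep_eq)
  also have "enn2ereal (ennreal c) = ereal c" using assms(3) by (rule enn2ereal_ennreal)
  finally have "ext_expectation M X \<le> ereal c - 0"
    unfolding ext_expectation_def by (intro ereal_minus_mono) auto
  then show ?thesis by simp
qed

lemma expected_oracle_calls:
  assumes "prob_space Q" and "0 \<le> p" "p \<le> 1"
  shows "(\<integral>\<omega>. real (oracle_calls N K \<omega>) \<partial>draws Q p) = real N + real K * (p * real N + 2)"
proof -
  let ?B = "measure_pmf (bernoulli_pmf p)"
  interpret Q: prob_space Q by fact
  interpret QB: pair_prob_space Q ?B ..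
  interpret D: prob_space "draws Q p"
    unfolding draws_def by (rule prob_space_PiM) (rule QB.prob_space_axioms)
  define c :: "'a \<times> bool \<Rightarrow> real" where "c x = (if snd x then real N else 0)" for x
  have [measurable]: "(\<lambda>b. if b then real N else 0) \<in> borel_measurable ?B" by simp
  have c[measurable]: "c \<in> borel_measurable (Q \<Otimes>\<^sub>M ?B)"
    unfolding c_def by measurable
  have coord[measurable]: "(\<lambda>\<omega>. \<omega> k) \<in> measurable (draws Q p) (Q \<Otimes>\<^sub>M ?B)" for k
    unfolding draws_def by measurable
  have int: "integrable (draws Q p) (\<lambda>\<omega>. c (\<omega> k))" for k
    by (rule D.integrable_const_bound[of _ "real N"]) (auto simp: c_def[abs_def])
  have "(\<integral>\<omega>. c (\<omega> k) \<partial>draws Q p) = p * real N" for k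
  proof -
    have "(\<integral>\<omega>. c (\<omega> k) \<partial>draws Q p) = (\<integral>x. c x \<partial>distr (draws Q p) (Q \<Otimes>\<^sub>M ?B) (\<lambda>\<omega>. \<omega> k))"
      by (subst integral_distr) auto
    also have "distr (draws Q p) (Q \<Otimes>\<^sub>M ?B) (\<lambda>\<omega>. \<omega> k) = Q \<Otimes>\<^sub>M ?B"
      unfolding draws_def by (rule distr_PiM_component) (auto intro: QB.prob_space_axioms)
    also have "(\<integral>x. c x \<partial>(Q \<Otimes>\<^sub>M ?B)) = (\<integral>i. (\<integral>b. c (i, b) \<partial>?B) \<partial>Q)"
      by (rule QB.integral_fst'[symmetric], rule QB.integrable_const_bound[of _ "real N"])
        (auto simp: c_def[abs_def])
    also have "\<dots> = p * real N"
      using assms by (simp add: c_def Q.prob_space)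
    finally show ?thesis .
  qed
  moreover have "real (oracle_calls N K \<omega>) = real N + real K * 2 + (\<Sum>k<K. c (\<omega> k))" for \<omega>
  proof -
    have "real (\<Sum>k<K. 2 + (if snd (\<omega> k) then N else 0)) = (\<Sum>k<K. 2 + c (\<omega> k))"
      unfolding of_nat_sum c_def by (intro sum.cong) auto
    then show ?thesis
      unfolding oracle_calls_def by (simp add: sum.distrib)
  qed
  ultimately show ?thesis
    using int by (simp add: D.prob_space algebra_simps)
qed

section \<open>The whole run and its complexity\<close>

context vr_extragradient
begin

abbreviation \<mu> :: "('i \<times> bool) measure" where
  "\<mu> \<equiv> Q \<Otimes>\<^sub>M measure_pmf (bernoulli_pmf p)"

lemma prob_space_\<mu>: "prob_space \<mu>"
proof -
  interpret Q: prob_space Q by (rule prob_Q)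
  interpret QB: pair_prob_space Q "measure_pmf (bernoulli_pmf p)" ..
  show ?thesis by (rule QB.prob_space_axioms)
qed

definition z_iter :: "(nat \<Rightarrow> 'i \<times> bool) \<Rightarrow> nat \<Rightarrow> 'a" where
  "z_iter \<omega> k = fst (iterates g F F\<^sub>\<xi> (1 - p) \<tau> z0 \<omega> k)"

definition w_iter :: "(nat \<Rightarrow> 'i \<times> bool) \<Rightarrow> nat \<Rightarrow> 'a" where
  "w_iter \<omega> k = snd (iterates g F F\<^sub>\<xi> (1 - p) \<tau> z0 \<omega> k)"

text \<open>
  The accumulated \<open>incr\<close>, started at \<open>\<Phi> zs z0 z0\<close> so that it dominates \<open>\<Phi> zs\<close> along the run.
\<close>

definition majorant :: "(nat \<Rightarrow> 'i \<times> bool) \<Rightarrow> nat \<Rightarrow> real" where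
  "majorant \<omega> k = \<Phi> zs z0 z0 + (\<Sum>j<k. incr (\<omega> j) (z_iter \<omega> j) (w_iter \<omega> j))"

definition drift_sum :: "(nat \<Rightarrow> 'i \<times> bool) \<Rightarrow> nat \<Rightarrow> 'a" where
  "drift_sum \<omega> k = (\<Sum>j<k. drift (\<omega> j) (z_iter \<omega> j) (w_iter \<omega> j))"

definition run_potential :: "(nat \<Rightarrow> 'i \<times> bool) \<Rightarrow> nat \<Rightarrow> real" where
  "run_potential \<omega> k = potential (majorant \<omega> k) (drift_sum \<omega> k) (z_iter \<omega> k) (w_iter \<omega> k)"

lemma iterates_0 [simp]: "z_iter \<omega> 0 = z0" "w_iter \<omega> 0 = z0"
  unfolding z_iter_def w_iter_def by simp_all

lemma iterates_Suc [simp]: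
  "z_iter \<omega> (Suc k) = full (fst (\<omega> k)) (z_iter \<omega> k) (w_iter \<omega> k)"
  "w_iter \<omega> (Suc k) = snap (\<omega> k) (z_iter \<omega> k) (w_iter \<omega> k)"
  unfolding z_iter_def w_iter_def snap_def full_def by (simp_all add: case_prod_beta Let_def)

lemma half_iterate_eq: "half_iterate g F F\<^sub>\<xi> (1 - p) \<tau> z0 \<omega> k = half (z_iter \<omega> k) (w_iter \<omega> k)"
  unfolding half_iterate_def half_def z_iter_def w_iter_def by (simp add: case_prod_beta)

lemma w_iter_dom: "w_iter \<omega> k \<in> eff_dom g"
  by (induction k) (simp_all add: z0_dom snap_dom)

lemma iterates_past:
  assumes "\<And>j. j < k \<Longrightarrow> \<omega> j = \<omega>' j"
  shows "z_iter \<omega> k = z_iter \<omega>' k \<and> w_iter \<omega> k = w_iter \<omega>' k"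
  using assms by (induction k) auto

lemma sums_past:
  assumes "\<And>j. j < k \<Longrightarrow> \<omega> j = \<omega>' j"
  shows "majorant \<omega> k = majorant \<omega>' k" "drift_sum \<omega> k = drift_sum \<omega>' k"
proof -
  have "\<omega> j = \<omega>' j \<and> z_iter \<omega> j = z_iter \<omega>' j \<and> w_iter \<omega> j = w_iter \<omega>' j" if "j < k" for j
    using iterates_past[of j \<omega> \<omega>'] assms that by auto
  then show "majorant \<omega> k = majorant \<omega>' k" "drift_sum \<omega> k = drift_sum \<omega>' k"
    unfolding majorant_def drift_sum_def by (auto intro!: arg_cong2[of _ _ _ _ "(+)"] sum.cong)
qed

lemma measurable_draw: "(\<lambda>\<omega>. \<omega> k) \<in> measurable (draws Q p) \<mu>"
  unfolding draws_def by measurable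

lemma borel_measurable_iterates:
  "(\<lambda>\<omega>. z_iter \<omega> k) \<in> borel_measurable (draws Q p) \<and> (\<lambda>\<omega>. w_iter \<omega> k) \<in> borel_measurable (draws Q p)"
proof (induction k)
  case (Suc k)
  then show ?case
    unfolding iterates_Suc
    by (intro conjI borel_measurable_full borel_measurable_snap measurable_draw w_iter_dom) auto
qed simp

lemmas borel_measurable_z_iter = borel_measurable_iterates[THEN conjunct1]
  and borel_measurable_w_iter = borel_measurable_iterates[THEN conjunct2]

lemma borel_measurable_majorant: "(\<lambda>\<omega>. majorant \<omega> k) \<in> borel_measurable (draws Q p)"
  unfolding majorant_def
  by (intro borel_measurable_add borel_measurable_sum borel_measurable_const borel_measurable_incr
      borel_measurable_z_iter borel_measurable_w_iter measurable_draw w_iter_dom)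

lemma borel_measurable_drift_sum: "(\<lambda>\<omega>. drift_sum \<omega> k) \<in> borel_measurable (draws Q p)"
  unfolding drift_sum_def
  by (intro borel_measurable_sum borel_measurable_drift
      borel_measurable_z_iter borel_measurable_w_iter measurable_draw w_iter_dom)

lemma borel_measurable_run_potential: "(\<lambda>\<omega>. run_potential \<omega> k) \<in> borel_measurable (draws Q p)"
  unfolding run_potential_def potential_def \<Phi>_def
  using borel_measurable_z_iter borel_measurable_w_iter borel_measurable_majorant borel_measurable_drift_sum by measurable

lemma run_potential_Suc: "run_potential \<omega> (Suc k) = potential_next (majorant \<omega> k) (drift_sum \<omega> k) (z_iter \<omega> k) (w_iter \<omega> k) (\<omega> k)"
  unfolding run_potential_def potential_next_def by (simp add: majorant_def drift_sum_def add.assoc)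

lemma majorant_dominates: "\<Phi> zs (z_iter \<omega> k) (w_iter \<omega> k) \<le> majorant \<omega> k"
proof (induction k)
  case (Suc k)
  then show ?case using incr_keeps_domination[OF Suc, of "\<omega> k"] by (simp add: majorant_def)
qed (simp add: majorant_def)

lemma run_potential_nonneg: "0 \<le> run_potential \<omega> k"
  using majorant_dominates[of \<omega> k] \<Phi>_nonneg[of zs "z_iter \<omega> k" "w_iter \<omega> k"] weight_pos
  unfolding run_potential_def potential_def by simp

lemma run_potential_supermartingale:
  "(\<integral>\<^sup>+\<omega>. ennreal (run_potential \<omega> (Suc k)) \<partial>draws Q p) \<le> (\<integral>\<^sup>+\<omega>. ennreal (run_potential \<omega> k) \<partial>draws Q p)"
proof -
  define h where "h = (\<lambda>(\<omega>, x). ennreal (potential_next (majorant \<omega> k) (drift_sum \<omega> k) (z_iter \<omega> k) (w_iter \<omega> k) x))"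
  note comp = measurable_compose[OF measurable_fst[of "draws Q p" \<mu>]]
  have h_meas: "h \<in> borel_measurable (draws Q p \<Otimes>\<^sub>M \<mu>)"
    unfolding h_def case_prod_beta'
    by (intro measurable_ennreal[THEN measurable_compose[rotated]] borel_measurable_potential_next
        comp[OF borel_measurable_z_iter] comp[OF borel_measurable_w_iter] comp[OF borel_measurable_majorant]
        comp[OF borel_measurable_drift_sum] measurable_snd w_iter_dom)
  have h_past: "h (\<omega>, x) = h (\<omega>', x)" if "\<And>j. j < k \<Longrightarrow> \<omega> j = \<omega>' j" for \<omega> \<omega>' x
    unfolding h_def using iterates_past[of k \<omega> \<omega>'] sums_past[of k \<omega> \<omega>'] that by simp
  have "(\<integral>\<^sup>+\<omega>. h (\<omega>, \<omega> k) \<partial>draws Q p) = (\<integral>\<^sup>+\<omega>. (\<integral>\<^sup>+x. h (\<omega>, x) \<partial>\<mu>) \<partial>draws Q p)"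
    unfolding draws_def
  proof (rule nn_integral_draw_independent_of_past)
    show "h \<in> borel_measurable ((\<Pi>\<^sub>M i\<in>UNIV. \<mu>) \<Otimes>\<^sub>M \<mu>)"
      using h_meas unfolding draws_def .
  qed (rule prob_space_\<mu>, rule h_past)
  also have "\<dots> \<le> (\<integral>\<^sup>+\<omega>. ennreal (run_potential \<omega> k) \<partial>draws Q p)"
    unfolding h_def run_potential_def prod.case by (intro nn_integral_mono potential_next_mean w_iter_dom majorant_dominates)
  finally show ?thesis unfolding run_potential_Suc h_def by simp
qed

lemma run_potential_mean: "(\<integral>\<^sup>+\<omega>. ennreal (run_potential \<omega> k) \<partial>draws Q p) \<le> ennreal ((1 + weight) * \<Phi> zs z0 z0)"
proof (induction k)
  case 0
  have "prob_space (draws Q p)"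
    unfolding draws_def by (intro prob_space_PiM prob_space_\<mu>)
  then show ?case
    by (simp add: run_potential_def potential_def majorant_def drift_sum_def prob_space.emeasure_space_1 algebra_simps)
next
  case (Suc k)
  then show ?case using run_potential_supermartingale order_trans by blast
qed

lemma gap_sum_le:
  assumes "v \<in> eff_dom g"
  shows "(\<Sum>j<k. 2 * \<tau> * (F v \<bullet> (half (z_iter \<omega> j) (w_iter \<omega> j) - v) + G (half (z_iter \<omega> j) (w_iter \<omega> j)) - G v))
      + \<Phi> v (z_iter \<omega> k) (w_iter \<omega> k)
    \<le> \<Phi> v z0 z0 + (majorant \<omega> k - \<Phi> zs z0 z0) - drift_sum \<omega> k \<bullet> (v - zs)"
proof (induction k)
  case (Suc k)
  with telescoping_step[OF assms, of "z_iter \<omega> k" "w_iter \<omega> k" "\<omega> k"] show ?case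
    by (simp add: majorant_def drift_sum_def inner_add_left)
qed (simp add: majorant_def drift_sum_def)

lemma \<Phi>_start_le:
  assumes "norm (v - z0) \<le> R"
  shows "\<Phi> v z0 z0 \<le> 2 * R\<^sup>2"
proof -
  have "(norm (z0 - v))\<^sup>2 \<le> R\<^sup>2" using assms by (simp add: norm_minus_commute power_mono)
  moreover have "(1 - p) * (norm (z0 - v))\<^sup>2 \<le> 1 * (norm (z0 - v))\<^sup>2"
    using p_pos by (intro mult_right_mono) auto
  ultimately show ?thesis unfolding \<Phi>_def by linarith
qed

lemma avg_output_eq:
  "avg_output g F F\<^sub>\<xi> (1 - p) \<tau> z0 K \<omega> = (\<Sum>j<K. (1 / real K) *\<^sub>R half (z_iter \<omega> j) (w_iter \<omega> j))"
  unfolding avg_output_def half_iterate_eq by (simp add: scaleR_sum_right)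

lemma avg_output_dom:
  assumes "K \<ge> 1"
  shows "avg_output g F F\<^sub>\<xi> (1 - p) \<tau> z0 K \<omega> \<in> eff_dom g"
  unfolding avg_output_eq using assms by (intro convex_sum convex_dom half_dom) auto

text \<open>
  Convexity of \<open>g\<close> passes from the average of the gap terms to the gap term of the average. The term
  \<open>- drift_sum \<omega> K \<bullet> (v - zs)\<close>, where \<open>v\<close> may be chosen with knowledge of the whole run, is split
  by \<open>2 |a \<bullet> b| \<le> |a|\<^sup>2 + |b|\<^sup>2\<close>, which makes the bound uniform in \<open>v\<close>. Of the \<open>4 R\<^sup>2\<close>, one
  half comes from \<open>\<Phi> v z0 z0\<close> and the other from \<open>|v - zs|\<^sup>2 / 2\<close>.
\<close>

lemma gap_at_average_le:
  fixes \<omega> K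
  defines "zbar \<equiv> avg_output g F F\<^sub>\<xi> (1 - p) \<tau> z0 K \<omega>"
  assumes K: "K \<ge> 1" and v: "v \<in> eff_dom g" and vR: "norm (v - z0) \<le> R" and zsR: "norm (zs - z0) \<le> R"
  shows "F v \<bullet> (zbar - v) + G zbar - G v \<le> (4 * R\<^sup>2 + run_potential \<omega> K) / (2 * \<tau> * real K)"
proof -
  let ?h = "\<lambda>j. half (z_iter \<omega> j) (w_iter \<omega> j)"
  have "G zbar \<le> (\<Sum>j<K. 1 / real K * G (?h j))"
    unfolding zbar_def avg_output_eq
    using K by (intro convex_on_sum[OF _ _ convex_on_G] half_dom) (auto simp: lessThan_empty_iff)
  then have "real K * G zbar \<le> (\<Sum>j<K. G (?h j))"
    using K by (simp add: sum_divide_distrib[symmetric] field_simps)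
  moreover have "real K * (F v \<bullet> (zbar - v)) = (\<Sum>j<K. F v \<bullet> (?h j - v))"
    unfolding zbar_def avg_output_eq using K
    by (simp add: inner_diff_right inner_sum_right sum_subtractf sum_divide_distrib[symmetric] field_simps)
  ultimately have "real K * (F v \<bullet> (zbar - v) + G zbar - G v)
      \<le> (\<Sum>j<K. F v \<bullet> (?h j - v) + G (?h j) - G v)"
    by (simp add: sum.distrib sum_subtractf algebra_simps)
  then have "2 * \<tau> * (real K * (F v \<bullet> (zbar - v) + G zbar - G v))
      \<le> 2 * \<tau> * (\<Sum>j<K. F v \<bullet> (?h j - v) + G (?h j) - G v)"
    using \<tau>_pos by (intro mult_left_mono) auto
  also have "\<dots> \<le> \<Phi> v z0 z0 + (majorant \<omega> K - \<Phi> zs z0 z0) - drift_sum \<omega> K \<bullet> (v - zs)"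
    using gap_sum_le[OF v, where k = K and \<omega> = \<omega>] \<Phi>_nonneg[of v "z_iter \<omega> K" "w_iter \<omega> K"]
    by (simp add: sum_distrib_left)
  also have "- (drift_sum \<omega> K \<bullet> (v - zs)) \<le> 1/2 * (norm (drift_sum \<omega> K))\<^sup>2 + 1/2 * (norm (v - zs))\<^sup>2"
  proof -
    have "0 \<le> (norm (drift_sum \<omega> K + (v - zs)))\<^sup>2" by simp
    also have "\<dots> = (norm (drift_sum \<omega> K))\<^sup>2 + 2 * (drift_sum \<omega> K \<bullet> (v - zs)) + (norm (v - zs))\<^sup>2"
      unfolding power2_norm_eq_inner by (simp add: inner_add_left inner_add_right inner_commute)
    finally show ?thesis by simp
  qed
  then have "\<Phi> v z0 z0 + (majorant \<omega> K - \<Phi> zs z0 z0) - drift_sum \<omega> K \<bullet> (v - zs)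
      \<le> 4 * R\<^sup>2 + run_potential \<omega> K"
  proof -
    have "norm (v - zs) \<le> 2 * R"
      using norm_triangle_ineq4[of "v - z0" "zs - z0"] vR zsR by simp
    then have "(norm (v - zs))\<^sup>2 \<le> (2 * R)\<^sup>2" by (intro power_mono) auto
    moreover have "0 \<le> weight * \<Phi> zs (z_iter \<omega> K) (w_iter \<omega> K)" using weight_pos \<Phi>_nonneg by simp
    ultimately show ?thesis
      using \<open>- (drift_sum \<omega> K \<bullet> (v - zs)) \<le> _\<close> \<Phi>_start_le[OF vR] \<Phi>_nonneg[of zs z0 z0]
      unfolding run_potential_def potential_def by (simp add: power_mult_distrib)
  qed
  finally show ?thesis
    using \<tau>_pos K by (simp add: pos_le_divide_eq ac_simps)
qed

text \<open>
  As a supremum of lower semicontinuous functions the gap has closed sublevel sets, so the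
  uncountable supremum causes no difficulty.
\<close>

lemma borel_measurable_Gap: "Gap g F C \<in> borel_measurable borel"
proof (rule borel_measurableI_le)
  fix y :: ereal
  have "closed {w. ereal (F z \<bullet> (w - z)) + g w - g z \<le> y}" if z: "z \<in> eff_dom g" for z
  proof (cases y)
    case (real r)
    have "ereal (F z \<bullet> (w - z)) + g w - g z \<le> y \<longleftrightarrow> g w \<le> ereal (r + G z - F z \<bullet> (w - z))" for w
      unfolding g_eq_G[OF z] real
      by (cases "w \<in> eff_dom g") (auto simp: g_eq_G g_outside algebra_simps)
    moreover have "closed {w. g w \<le> ereal (r + G z - F z \<bullet> (w - z))}"
      by (intro closed_sublevel_of_lsc lsc continuous_intros)
    ultimately show ?thesis by simp
  next
    case MInf
    have "ereal (F z \<bullet> (w - z)) + g w - g z \<noteq> - \<infinity>" for w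
      unfolding g_eq_G[OF z] by (cases "w \<in> eff_dom g") (auto simp: g_eq_G g_outside)
    then show ?thesis using MInf by simp
  qed simp
  then have "closed (\<Inter>z\<in>C \<inter> eff_dom g. {w. ereal (F z \<bullet> (w - z)) + g w - g z \<le> y})"
    by auto
  also have "(\<Inter>z\<in>C \<inter> eff_dom g. {w. ereal (F z \<bullet> (w - z)) + g w - g z \<le> y}) = {w \<in> space borel. Gap g F C w \<le> y}"
    unfolding Gap_def by (auto simp: SUP_le_iff)
  finally show "{w \<in> space borel. Gap g F C w \<le> y} \<in> sets borel"
    by (rule borel_closed)
qed

text \<open>
  The initial potential is \<open>(1 + weight) \<Phi> zs z0 z0 \<le> 2 (1 + weight) R\<^sup>2\<close>; together with \<open>4 R\<^sup>2\<close>
  from \<open>gap_at_average_le\<close> and after division by \<open>2 \<tau> K\<close> this is the stated accuracy.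
\<close>

lemma average_accurate:
  assumes C: "\<And>z. z \<in> C \<Longrightarrow> norm (z - z0) \<le> R" and zsR: "norm (zs - z0) \<le> R"
    and K: "K \<ge> 1" and \<epsilon>: "(3 + weight) * R\<^sup>2 / (\<tau> * real K) \<le> \<epsilon>"
  shows "accurate g F C (draws Q p) (avg_output g F F\<^sub>\<xi> (1 - p) \<tau> z0 K) \<epsilon>"
proof -
  let ?out = "avg_output g F F\<^sub>\<xi> (1 - p) \<tau> z0 K"
  define s where "s = 1 / (2 * \<tau> * real K)"
  have s: "0 \<le> s" unfolding s_def using \<tau>_pos by simp
  have [measurable]: "(\<lambda>\<omega>. run_potential \<omega> K) \<in> borel_measurable (draws Q p)" by (rule borel_measurable_run_potential)
  have "?out \<in> borel_measurable (draws Q p)"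
    unfolding avg_output_eq
    by (intro borel_measurable_sum borel_measurable_scaleR borel_measurable_const
        borel_measurable_half borel_measurable_z_iter borel_measurable_w_iter w_iter_dom)
  then have meas: "(\<lambda>\<omega>. Gap g F C (?out \<omega>)) \<in> borel_measurable (draws Q p)"
    by (rule measurable_compose[OF _ borel_measurable_Gap])
  have "ext_expectation (draws Q p) (\<lambda>\<omega>. Gap g F C (?out \<omega>)) \<le> ereal ((3 + weight) * R\<^sup>2 / (\<tau> * real K))"
  proof (rule ext_expectation_le)
    fix \<omega>
    show "Gap g F C (?out \<omega>) \<le> ereal (s * (4 * R\<^sup>2 + run_potential \<omega> K))"
      unfolding Gap_def
    proof (rule SUP_least)
      fix v assume v: "v \<in> C \<inter> eff_dom g"
      then have "F v \<bullet> (?out \<omega> - v) + G (?out \<omega>) - G v \<le> s * (4 * R\<^sup>2 + run_potential \<omega> K)"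
        unfolding s_def using gap_at_average_le[OF K _ C zsR, of v \<omega>] by simp
      then show "ereal (F v \<bullet> (?out \<omega> - v)) + g (?out \<omega>) - g v \<le> ereal (s * (4 * R\<^sup>2 + run_potential \<omega> K))"
        using v g_eq_G[OF avg_output_dom[OF K]] by (simp add: g_eq_G)
    qed
  next
    have "prob_space (draws Q p)"
      unfolding draws_def by (intro prob_space_PiM prob_space_\<mu>)
    then have "(\<integral>\<^sup>+\<omega>. ennreal (s * (4 * R\<^sup>2 + run_potential \<omega> K)) \<partial>draws Q p)
        = ennreal s * (ennreal (4 * R\<^sup>2) + (\<integral>\<^sup>+\<omega>. ennreal (run_potential \<omega> K) \<partial>draws Q p))"
      using s run_potential_nonneg
      by (simp add: ennreal_mult ennreal_plus nn_integral_cmult nn_integral_add prob_space.emeasure_space_1)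
    also have "\<dots> \<le> ennreal s * (ennreal (4 * R\<^sup>2) + ennreal ((1 + weight) * \<Phi> zs z0 z0))"
      by (intro mult_left_mono add_left_mono run_potential_mean) auto
    also have "\<dots> = ennreal (s * (4 * R\<^sup>2 + (1 + weight) * \<Phi> zs z0 z0))"
      using s weight_pos \<Phi>_nonneg[of zs z0 z0] by (simp add: ennreal_mult ennreal_plus)
    also have "\<dots> \<le> ennreal ((3 + weight) * R\<^sup>2 / (\<tau> * real K))"
    proof (rule ennreal_leI)
      have "(1 + weight) * \<Phi> zs z0 z0 \<le> (1 + weight) * (2 * R\<^sup>2)"
        using weight_pos by (intro mult_left_mono \<Phi>_start_le zsR) auto
      then have "s * (4 * R\<^sup>2 + (1 + weight) * \<Phi> zs z0 z0) \<le> s * (2 * ((3 + weight) * R\<^sup>2))"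
        using s by (intro mult_left_mono) (auto simp: algebra_simps)
      also have "\<dots> = (3 + weight) * R\<^sup>2 / (\<tau> * real K)"
        unfolding s_def by simp
      finally show "s * (4 * R\<^sup>2 + (1 + weight) * \<Phi> zs z0 z0) \<le> (3 + weight) * R\<^sup>2 / (\<tau> * real K)" .
    qed
    finally show "(\<integral>\<^sup>+\<omega>. ennreal (s * (4 * R\<^sup>2 + run_potential \<omega> K)) \<partial>draws Q p)
        \<le> ennreal ((3 + weight) * R\<^sup>2 / (\<tau> * real K))" .
  qed (use weight_pos \<tau>_pos in auto)
  with meas \<epsilon> show ?thesis
    unfolding accurate_def by (meson ereal_less_eq(3) order_trans)
qed

lemma complexity_bound:
  assumes C: "\<And>z. z \<in> C \<Longrightarrow> norm (z - z0) \<le> R" and zsR: "norm (zs - z0) \<le> R" and \<epsilon>: "0 < \<epsilon>"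
  shows "avg_total_complexity g F Q F\<^sub>\<xi> C N p (1 - p) \<tau> z0 \<epsilon>
    \<le> ereal (real N + (p * real N + 2) * (1 + (3 + weight) * R\<^sup>2 / \<gamma> * (L / (sqrt p * \<epsilon>))))"
proof -
  define q where "q = (3 + weight) * R\<^sup>2 / \<gamma> * (L / (sqrt p * \<epsilon>))"
  have q: "q = (3 + weight) * R\<^sup>2 / (\<tau> * \<epsilon>)"
    unfolding q_def \<tau>_def using L_pos p_pos \<gamma>_pos by (simp add: field_simps)
  have q0: "0 \<le> q" unfolding q using weight_pos \<tau>_pos \<epsilon> by simp
  define K where "K = max 1 (nat \<lceil>q\<rceil>)"
  have K1: "K \<ge> 1" unfolding K_def by simp
  have "q \<le> real K" unfolding K_def using q0 by linarith
  then have "(3 + weight) * R\<^sup>2 / (\<tau> * real K) \<le> \<epsilon>"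
    unfolding q using \<tau>_pos \<epsilon> K1 by (simp add: field_simps)
  then have "accurate g F C (draws Q p) (avg_output g F F\<^sub>\<xi> (1 - p) \<tau> z0 K) \<epsilon>"
    by (intro average_accurate[where R = R] C zsR K1)
  then have "avg_total_complexity g F Q F\<^sub>\<xi> C N p (1 - p) \<tau> z0 \<epsilon>
      \<le> ereal (\<integral>\<omega>. real (oracle_calls N K \<omega>) \<partial>draws Q p)"
    unfolding avg_total_complexity_def using K1 by (intro INF_lower) auto
  also have "\<dots> = ereal (real N + (p * real N + 2) * real K)"
    using p_pos p_le_1 by (simp add: expected_oracle_calls[OF prob_Q] ac_simps)
  also have "\<dots> \<le> ereal (real N + (p * real N + 2) * (1 + q))"
  proof -
    have "real K \<le> 1 + q" unfolding K_def using q0 by linarith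
    then have "(p * real N + 2) * real K \<le> (p * real N + 2) * (1 + q)"
      using p_pos by (intro mult_left_mono) auto
    then show ?thesis by simp
  qed
  finally show ?thesis unfolding q_def .
qed

end

theorem corollary2p7:
  fixes \<gamma> R :: real
  assumes "0 < \<gamma>" and "\<gamma> < 1"
  shows "\<exists>c>0. \<forall>(g :: 'a::euclidean_space \<Rightarrow> ereal) (F :: 'a \<Rightarrow> 'a) (Q :: 'i measure)
            (F\<^sub>\<xi> :: 'i \<Rightarrow> 'a \<Rightarrow> 'a) (L :: real) (C :: 'a set) (z0 :: 'a)
            (N :: nat) (p :: real) (\<alpha> :: real) (\<tau> :: real) (\<epsilon> :: real).
          stochastic_vi g F Q F\<^sub>\<xi> L \<and>
          compact C \<and> (\<forall>z\<in>C. norm (z - z0) \<le> R) \<and>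
          z0 \<in> eff_dom g \<and> (\<exists>zs\<in>vi_solutions g F. norm (zs - z0) \<le> R) \<and>
          0 < p \<and> p \<le> 1 \<and> \<alpha> = 1 - p \<and> \<tau> = sqrt (1 - \<alpha>) / L * \<gamma> \<and> 0 < \<epsilon>
          \<longrightarrow>
          avg_total_complexity g F Q F\<^sub>\<xi> C N p \<alpha> \<tau> z0 \<epsilon>
            \<le> ereal (c * (real N + (p * real N + 2) * (1 + L / (sqrt p * \<epsilon>)))) \<and>
          (p = 2 / real N \<longrightarrow>
           avg_total_complexity g F Q F\<^sub>\<xi> C N p \<alpha> \<tau> z0 \<epsilon>
            \<le> ereal (c * (real N + sqrt (real N) * L / \<epsilon>)))"
proof -
  \<comment> \<open>\<open>b\<close> is the constant of \<open>complexity_bound\<close>, made at least \<open>1\<close>; the further factor \<open>4\<close> is the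
    mean cost of an iteration for \<open>p = 2 / N\<close>.\<close>
  define b where "b = max 1 ((3 + 7 / (1 - \<gamma>)) * R\<^sup>2 / \<gamma>)"
  have b1: "1 \<le> b" unfolding b_def by simp
  show ?thesis
  proof (intro exI[of _ "4 * b"] conjI allI impI; (elim conjE bexE)?)
    show "0 < 4 * b" using b1 by simp
  next
    fix g :: "'a \<Rightarrow> ereal" and F :: "'a \<Rightarrow> 'a" and Q :: "'i measure" and F\<^sub>\<xi> :: "'i \<Rightarrow> 'a \<Rightarrow> 'a"
      and L :: real and C :: "'a set" and z0 :: 'a and N :: nat and p \<alpha> \<tau> \<epsilon> :: real and zs
    assume vi: "stochastic_vi g F Q F\<^sub>\<xi> L" and C: "\<forall>z\<in>C. norm (z - z0) \<le> R"
      and z0: "z0 \<in> eff_dom g" and zs: "zs \<in> vi_solutions g F" "norm (zs - z0) \<le> R"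
      and p: "0 < p" "p \<le> 1" and \<alpha>: "\<alpha> = 1 - p" and \<tau>: "\<tau> = sqrt (1 - \<alpha>) / L * \<gamma>" and \<epsilon>: "0 < \<epsilon>"
    interpret vi: stochastic_vi g F Q F\<^sub>\<xi> L by (rule vi)
    interpret vr: vr_extragradient g F Q F\<^sub>\<xi> L p \<gamma> z0 zs
      by unfold_locales (use z0 zs p assms in auto)
    have \<tau>': "\<tau> = vr.\<tau>" unfolding \<tau> \<alpha> vr.\<tau>_def by simp
    define r where "r = L / (sqrt p * \<epsilon>)"
    have r0: "0 \<le> r" unfolding r_def using vi.L_pos p \<epsilon> by simp
    have "avg_total_complexity g F Q F\<^sub>\<xi> C N p \<alpha> \<tau> z0 \<epsilon>
        \<le> ereal (real N + (p * real N + 2) * (1 + (3 + vr.weight) * R\<^sup>2 / \<gamma> * r))"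
      unfolding \<tau>' \<alpha> r_def using vr.complexity_bound[of C R \<epsilon> N] C zs \<epsilon> by auto
    also have "\<dots> \<le> ereal (real N + (p * real N + 2) * (1 + b * r))"
      using r0 p unfolding b_def vr.weight_def ereal_less_eq
      by (intro add_left_mono mult_left_mono mult_right_mono) auto
    finally have main: "avg_total_complexity g F Q F\<^sub>\<xi> C N p \<alpha> \<tau> z0 \<epsilon>
        \<le> ereal (real N + (p * real N + 2) * (1 + b * r))" .
    have "real N + (p * real N + 2) * (1 + b * r) \<le> 4 * b * real N + (p * real N + 2) * (4 * b * (1 + r))"
    proof (intro add_mono mult_left_mono)
      show "real N \<le> 4 * b * real N" using b1 mult_right_mono[of 1 "4 * b" "real N"] by simp
      have "0 \<le> b * r" using b1 r0 by simp
      then show "1 + b * r \<le> 4 * b * (1 + r)" using b1 by (simp add: distrib_left)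
    qed (use p in auto)
    also have "\<dots> = 4 * b * (real N + (p * real N + 2) * (1 + r))"
      by (simp add: algebra_simps)
    finally show "avg_total_complexity g F Q F\<^sub>\<xi> C N p \<alpha> \<tau> z0 \<epsilon>
        \<le> ereal (4 * b * (real N + (p * real N + 2) * (1 + L / (sqrt p * \<epsilon>))))"
      unfolding r_def[symmetric] using main order_trans ereal_less_eq(3) by blast
    assume pN: "p = 2 / real N"
    \<comment> \<open>Now \<open>2 \<le> N\<close>, so that the \<open>4\<close> calls of a single iteration are at most \<open>2 N\<close>.\<close>
    then have N: "2 \<le> real N" "p * real N = 2" using p by (auto simp: field_simps split: if_splits)
    have "r \<le> sqrt (real N) * L / \<epsilon>"
    proof -
      have "1 / sqrt p = sqrt (real N / 2)" unfolding pN by (simp add: real_sqrt_divide)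
      also have "\<dots> \<le> sqrt (real N)" by simp
      finally have "1 / sqrt p * (L / \<epsilon>) \<le> sqrt (real N) * (L / \<epsilon>)"
        using vi.L_pos \<epsilon> by (intro mult_right_mono) auto
      then show ?thesis unfolding r_def by simp
    qed
    then have "b * r \<le> b * (sqrt (real N) * L / \<epsilon>)" using b1 by (intro mult_left_mono) auto
    moreover have "real N \<le> b * real N" using b1 mult_right_mono[of 1 b "real N"] by simp
    moreover have "real N + (p * real N + 2) * (1 + b * r) = real N + 4 + 4 * (b * r)"
      unfolding N(2) by simp
    ultimately have "real N + (p * real N + 2) * (1 + b * r) \<le> 4 * (b * real N) + 4 * (b * (sqrt (real N) * L / \<epsilon>))"
      using N(1) by linarith
    also have "\<dots> = 4 * b * (real N + sqrt (real N) * L / \<epsilon>)"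
      by (simp add: algebra_simps)
    finally show "avg_total_complexity g F Q F\<^sub>\<xi> C N p \<alpha> \<tau> z0 \<epsilon>
        \<le> ereal (4 * b * (real N + sqrt (real N) * L / \<epsilon>))"
      using main order_trans ereal_less_eq(3) by blast
  qed
qed

end
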